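(* Let $M_\nu^{m+1}$ be a semi-Riemannian manifold and let $\Sigma^m\subset M_\nu^{m+1}$ be a non-lightlike and orientable hypersurface with unit normal vector field $\xi$. Then $\Sigma^m$ is totally umbilical if, and only if, for every non-lightlike regular $C^2$ curve $\alpha:I\to\Sigma^m$ one has $$\begin{cases}\langle\alpha'',\alpha''\rangle_\nu\geq\eta H^2, & \text{if }\nabla^\Sigma_{\alpha'}\alpha'\text{ is not timelike},\\[3pt] \langle\alpha'',\alpha''\rangle_\nu\leq\eta H^2, & \text{if }\nabla^\Sigma_{\alpha'}\alpha'\text{ is not spacelike},\end{cases}$$ where $H=H(s)$ is the mean curvature of $\Sigma^m$ along $\alpha(s)$, $\eta=\langle\xi,\xi\rangle_\nu=\pm1$, $\alpha''=\nabla_{\alpha'}\alpha'$, and $\nabla^\Sigma$ is the induced connection on $\Sigma^m$. In addition, equality only holds when $\alpha$ is a geodesic.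
   Context: $M_\nu^{m+1}$ is an $(m+1)$-dimensional semi-Riemannian manifold with metric $\langle\cdot,\cdot\rangle_\nu$ of index $\nu$ and Levi-Civita connection $\nabla$. A vector $V\neq0$ is timelike, lightlike or spacelike according to whether $\langle V,V\rangle_\nu<0$, $=0$ or $>0$. A curve is lightlike if $\alpha'$ is lightlike at all of its points, and a hypersurface is lightlike if its induced metric is degenerate; the curves and hypersurfaces considered are non-lightlike and have the same causal character at all their points. Curves are parametrized so that $\langle\alpha',\alpha'\rangle_\nu=\pm1$. "Geodesic" in the last sentence of the claim means geodesic of $\Sigma^m$. The shape operator is $S_p(X)=-(\nabla_X\xi)(p)$, $X\in T_p\Sigma^m$. The hypersurface $\Sigma^m$ is totally umbilical if all of its points are umbilical, i.e., at each point $p$ every non-lightlike tangent vector is an eigenvector of $S_p$ (equivalently, $S_p$ is a multiple of the identity). The mean curvature is $H=\frac{\eta}{m}\,\mathrm{tr}(S)$.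
   Formalization: The last sentence is proved for totally umbilical Σ when ∇^Σ_{α'}α' is nowhere lightlike along α; without this it fails: in R^4_1 with Σ={x_3=0}, α(s)=(s²/2,s,s²/2,0) gives equality (H=0, α'' null) but is not a geodesic. *)

theory Defs
  imports "HOL-Analysis.Analysis"
begin

section \<open>Smooth maps between Euclidean spaces\<close>

text \<open>Intended for open \<open>U\<close>, where it is the usual notion of a \<open>k\<close> times continuously
  differentiable map.\<close>

primrec Ck_on :: "nat \<Rightarrow> ('a::euclidean_space \<Rightarrow> 'b::real_normed_vector) \<Rightarrow> 'a set \<Rightarrow> bool" where
  "Ck_on 0 f U \<longleftrightarrow> continuous_on U f"
| "Ck_on (Suc k) f U \<longleftrightarrow>
     f differentiable_on U \<and> (\<forall>v. Ck_on k (\<lambda>x. frechet_derivative f (at x) v) U)"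

definition smooth_on :: "('a::euclidean_space \<Rightarrow> 'b::real_normed_vector) \<Rightarrow> 'a set \<Rightarrow> bool" where
  "smooth_on f U \<longleftrightarrow> (\<forall>k. Ck_on k f U)"

definition C2_on :: "(real \<Rightarrow> 'a::real_normed_vector) \<Rightarrow> real set \<Rightarrow> bool" where
  "C2_on f J \<longleftrightarrow> (\<exists>f' f''.
     (\<forall>s\<in>J. (f has_vector_derivative f' s) (at s within J)) \<and>
     (\<forall>s\<in>J. (f' has_vector_derivative f'' s) (at s within J)) \<and>
     continuous_on J f'')"


section \<open>Smooth manifolds\<close>

text \<open>A chart is a pair of a domain and a coordinate map. An \<open>n\<close>-dimensional manifold is
  modelled on a Euclidean space type with \<open>DIM('a) = n\<close>.\<close>

type_synonym ('p, 'a) chart = "'p set \<times> ('p \<Rightarrow> 'a)"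

abbreviation cdom :: "('p, 'a) chart \<Rightarrow> 'p set" where "cdom c \<equiv> fst c"
abbreviation coord :: "('p, 'a) chart \<Rightarrow> 'p \<Rightarrow> 'a" where "coord c \<equiv> snd c"
abbreviation param :: "('p, 'a) chart \<Rightarrow> 'a \<Rightarrow> 'p" where "param c \<equiv> inv_into (fst c) (snd c)"

definition chart_on :: "'p topology \<Rightarrow> ('p, 'a::euclidean_space) chart \<Rightarrow> bool" where
  "chart_on T c \<longleftrightarrow>
     openin T (cdom c) \<and> open (coord c ` cdom c) \<and>
     homeomorphic_map (subtopology T (cdom c)) (top_of_set (coord c ` cdom c)) (coord c)"

definition smooth_manifold :: "'p topology \<Rightarrow> ('p, 'a::euclidean_space) chart set \<Rightarrow> bool" where
  "smooth_manifold T A \<longleftrightarrow>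
     Hausdorff_space T \<and> second_countable T \<and>
     (\<forall>c\<in>A. chart_on T c) \<and> topspace T = (\<Union>c\<in>A. cdom c) \<and>
     (\<forall>c\<in>A. \<forall>c'\<in>A. smooth_on (coord c' \<circ> param c) (coord c ` (cdom c \<inter> cdom c')))"

text \<open>Tangent vectors and tensors are given by their components in each chart. With \<open>c\<close>, \<open>c'\<close>
  charts of the same manifold, \<open>coord_deriv c c' p\<close> is the change of components from \<open>c\<close> to \<open>c'\<close>;
  with \<open>d\<close> a chart of a submanifold and \<open>c\<close> a chart of the ambient manifold,
  \<open>coord_deriv d c p\<close> is the differential of the inclusion at \<open>p\<close>.\<close>

definition coord_deriv ::
  "('p, 'a::euclidean_space) chart \<Rightarrow> ('p, 'b::euclidean_space) chart \<Rightarrow> 'p \<Rightarrow> 'a \<Rightarrow> 'b" where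
  "coord_deriv d c p = frechet_derivative (coord c \<circ> param d) (at (coord d p))"


section \<open>Semi-Riemannian metrics and the Levi-Civita connection\<close>

definition nondegenerate :: "('a::euclidean_space \<Rightarrow> 'a \<Rightarrow> real) \<Rightarrow> bool" where
  "nondegenerate b \<longleftrightarrow> (\<forall>u. (\<forall>v. b u v = 0) \<longrightarrow> u = 0)"

definition form_index :: "('a::euclidean_space \<Rightarrow> 'a \<Rightarrow> real) \<Rightarrow> nat" where
  "form_index b = Max {dim V | V. subspace V \<and> (\<forall>v\<in>V. v \<noteq> 0 \<longrightarrow> b v v < 0)}"

definition timelike :: "('a::euclidean_space \<Rightarrow> 'a \<Rightarrow> real) \<Rightarrow> 'a \<Rightarrow> bool" where
  "timelike b v \<longleftrightarrow> v \<noteq> 0 \<and> b v v < 0"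

definition lightlike :: "('a::euclidean_space \<Rightarrow> 'a \<Rightarrow> real) \<Rightarrow> 'a \<Rightarrow> bool" where
  "lightlike b v \<longleftrightarrow> v \<noteq> 0 \<and> b v v = 0"

definition spacelike :: "('a::euclidean_space \<Rightarrow> 'a \<Rightarrow> real) \<Rightarrow> 'a \<Rightarrow> bool" where
  "spacelike b v \<longleftrightarrow> v \<noteq> 0 \<and> b v v > 0"

type_synonym ('p, 'a) metric = "('p, 'a) chart \<Rightarrow> 'p \<Rightarrow> 'a \<Rightarrow> 'a \<Rightarrow> real"
type_synonym ('p, 'a) connection = "('p, 'a) chart \<Rightarrow> 'p \<Rightarrow> 'a \<Rightarrow> 'a \<Rightarrow> 'a"
type_synonym ('p, 'a) vector_field = "('p, 'a) chart \<Rightarrow> 'p \<Rightarrow> 'a"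

definition semi_riemannian_metric ::
  "('p, 'a::euclidean_space) chart set \<Rightarrow> ('p, 'a) metric \<Rightarrow> nat \<Rightarrow> bool" where
  "semi_riemannian_metric A g \<nu> \<longleftrightarrow>
     (\<forall>c\<in>A. \<forall>p\<in>cdom c.
        bilinear (g c p) \<and> (\<forall>u v. g c p u v = g c p v u) \<and>
        nondegenerate (g c p) \<and> form_index (g c p) = \<nu>) \<and>
     (\<forall>c\<in>A. \<forall>u v. smooth_on (\<lambda>x. g c (param c x) u v) (coord c ` cdom c)) \<and>
     (\<forall>c\<in>A. \<forall>c'\<in>A. \<forall>p\<in>cdom c \<inter> cdom c'. \<forall>u v.
        g c p u v = g c' p (coord_deriv c c' p u) (coord_deriv c c' p v))"

text \<open>\<open>\<Gamma> c p u v\<close> is the Christoffel bilinear map: in the chart \<open>c\<close> the covariant derivative of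
  a vector field \<open>Y\<close> in direction \<open>X\<close> is \<open>DY(X) + \<Gamma>(X, Y)\<close>. The two conditions below say that
  the connection is torsion-free and metric. Such \<open>\<Gamma>\<close> exists, and its values at
  \<open>c \<in> A\<close>, \<open>p \<in> cdom c\<close> are uniquely determined (Koszul formula), so smoothness in \<open>p\<close> and
  the transformation law under a change of chart are consequences.\<close>

definition levi_civita ::
  "('p, 'a::euclidean_space) chart set \<Rightarrow> ('p, 'a) metric \<Rightarrow> ('p, 'a) connection \<Rightarrow> bool" where
  "levi_civita A g \<Gamma> \<longleftrightarrow>
     (\<forall>c\<in>A. \<forall>p\<in>cdom c.
        bilinear (\<Gamma> c p) \<and> (\<forall>u v. \<Gamma> c p u v = \<Gamma> c p v u) \<and>
        (\<forall>w u v. frechet_derivative (\<lambda>x. g c (param c x) u v) (at (coord c p)) w =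
           g c p (\<Gamma> c p w u) v + g c p u (\<Gamma> c p w v)))"

definition semi_riemannian_manifold ::
  "'p topology \<Rightarrow> ('p, 'a::euclidean_space) chart set \<Rightarrow> ('p, 'a) metric \<Rightarrow> nat \<Rightarrow>
   ('p, 'a) connection \<Rightarrow> bool" where
  "semi_riemannian_manifold T A g \<nu> \<Gamma> \<longleftrightarrow>
     smooth_manifold T A \<and> semi_riemannian_metric A g \<nu> \<and> levi_civita A g \<Gamma>"


section \<open>Hypersurfaces\<close>

text \<open>A hypersurface is a subset \<open>S\<close> with the subspace topology and with a smooth structure
  (atlas \<open>B\<close>) of dimension one less for which the inclusion is a smooth immersion.\<close>

definition hypersurface ::
  "'p topology \<Rightarrow> ('p, 'a::euclidean_space) chart set \<Rightarrow>
   'p set \<Rightarrow> ('p, 'b::euclidean_space) chart set \<Rightarrow> bool" where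
  "hypersurface T A S B \<longleftrightarrow>
     S \<subseteq> topspace T \<and> DIM('a) = DIM('b) + 1 \<and> smooth_manifold (subtopology T S) B \<and>
     (\<forall>c\<in>A. \<forall>d\<in>B.
        smooth_on (coord c \<circ> param d) (coord d ` (cdom c \<inter> cdom d)) \<and>
        (\<forall>p\<in>cdom c \<inter> cdom d. inj (coord_deriv d c p)))"

definition induced_metric ::
  "('p, 'a::euclidean_space) metric \<Rightarrow> ('p, 'b::euclidean_space) chart \<Rightarrow> ('p, 'a) chart \<Rightarrow>
   'p \<Rightarrow> 'b \<Rightarrow> 'b \<Rightarrow> real" where
  "induced_metric g d c p u v = g c p (coord_deriv d c p u) (coord_deriv d c p v)"

definition non_lightlike_hypersurface ::
  "('p, 'a::euclidean_space) chart set \<Rightarrow> ('p, 'b::euclidean_space) chart set \<Rightarrow>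
   ('p, 'a) metric \<Rightarrow> bool" where
  "non_lightlike_hypersurface A B g \<longleftrightarrow>
     (\<forall>c\<in>A. \<forall>d\<in>B. \<forall>p\<in>cdom c \<inter> cdom d. nondegenerate (induced_metric g d c p))"

text \<open>\<open>\<xi>\<close> is a smooth vector field along the hypersurface; only its values at points of the
  hypersurface matter. That \<open>\<eta>\<close> is the same at all points is the constancy of the causal
  character of the hypersurface.\<close>

definition unit_normal_field ::
  "('p, 'a::euclidean_space) chart set \<Rightarrow> ('p, 'b::euclidean_space) chart set \<Rightarrow>
   ('p, 'a) metric \<Rightarrow> ('p, 'a) vector_field \<Rightarrow> real \<Rightarrow> bool" where
  "unit_normal_field A B g \<xi> \<eta> \<longleftrightarrow>
     (\<eta> = 1 \<or> \<eta> = -1) \<and>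
     (\<forall>c\<in>A. \<forall>d\<in>B.
        smooth_on (\<lambda>y. \<xi> c (param d y)) (coord d ` (cdom c \<inter> cdom d)) \<and>
        (\<forall>p\<in>cdom c \<inter> cdom d.
           g c p (\<xi> c p) (\<xi> c p) = \<eta> \<and>
           (\<forall>u. g c p (coord_deriv d c p u) (\<xi> c p) = 0) \<and>
           (\<forall>c'\<in>A. p \<in> cdom c' \<longrightarrow> \<xi> c' p = coord_deriv c c' p (\<xi> c p))))"

text \<open>Covariant derivative of \<open>\<xi>\<close> in the direction of the tangent vector \<open>u\<close> of the hypersurface
  (components of \<open>u\<close> with respect to \<open>d\<close>, result with respect to \<open>c\<close>).\<close>

definition cov_deriv ::
  "('p, 'a::euclidean_space) connection \<Rightarrow> ('p, 'a) vector_field \<Rightarrow>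
   ('p, 'b::euclidean_space) chart \<Rightarrow> ('p, 'a) chart \<Rightarrow> 'p \<Rightarrow> 'b \<Rightarrow> 'a" where
  "cov_deriv \<Gamma> \<xi> d c p u =
     frechet_derivative (\<lambda>y. \<xi> c (param d y)) (at (coord d p)) u +
     \<Gamma> c p (coord_deriv d c p u) (\<xi> c p)"

text \<open>The shape operator as an endomorphism of the tangent space of the hypersurface, in components
  with respect to \<open>d\<close>: the covariant derivative of \<open>\<xi>\<close> is tangent to the hypersurface and the
  differential of the inclusion is injective, so the vector described exists and is unique.\<close>

definition shape_operator ::
  "('p, 'a::euclidean_space) connection \<Rightarrow> ('p, 'a) vector_field \<Rightarrow>
   ('p, 'b::euclidean_space) chart \<Rightarrow> ('p, 'a) chart \<Rightarrow> 'p \<Rightarrow> 'b \<Rightarrow> 'b" where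
  "shape_operator \<Gamma> \<xi> d c p u = (THE w. coord_deriv d c p w = - cov_deriv \<Gamma> \<xi> d c p u)"

definition mean_curvature ::
  "('p, 'a::euclidean_space) connection \<Rightarrow> ('p, 'a) vector_field \<Rightarrow> real \<Rightarrow>
   ('p, 'b::euclidean_space) chart \<Rightarrow> ('p, 'a) chart \<Rightarrow> 'p \<Rightarrow> real" where
  "mean_curvature \<Gamma> \<xi> \<eta> d c p =
     \<eta> / real DIM('b) * (\<Sum>e\<in>Basis. shape_operator \<Gamma> \<xi> d c p e \<bullet> e)"

definition totally_umbilical ::
  "('p, 'a::euclidean_space) chart set \<Rightarrow> ('p, 'b::euclidean_space) chart set \<Rightarrow>
   ('p, 'a) metric \<Rightarrow> ('p, 'a) connection \<Rightarrow> ('p, 'a) vector_field \<Rightarrow> bool" where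
  "totally_umbilical A B g \<Gamma> \<xi> \<longleftrightarrow>
     (\<forall>c\<in>A. \<forall>d\<in>B. \<forall>p\<in>cdom c \<inter> cdom d. \<forall>u.
        u \<noteq> 0 \<and> \<not> lightlike (induced_metric g d c p) u \<longrightarrow>
        (\<exists>\<kappa>. shape_operator \<Gamma> \<xi> d c p u = \<kappa> *\<^sub>R u))"


section \<open>Curves\<close>

text \<open>\<open>I\<close> is any nondegenerate interval; at an endpoint belonging to \<open>I\<close> derivatives are
  one-sided.\<close>

definition C2_curve ::
  "'p topology \<Rightarrow> ('p, 'b::euclidean_space) chart set \<Rightarrow> real set \<Rightarrow> (real \<Rightarrow> 'p) \<Rightarrow> bool" where
  "C2_curve N B I \<alpha> \<longleftrightarrow>
     is_interval I \<and> interior I \<noteq> {} \<and> continuous_map (top_of_set I) N \<alpha> \<and>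
     (\<forall>d\<in>B. C2_on (coord d \<circ> \<alpha>) {s\<in>I. \<alpha> s \<in> cdom d})"

definition velocity ::
  "real set \<Rightarrow> (real \<Rightarrow> 'p) \<Rightarrow> ('p, 'a::euclidean_space) chart \<Rightarrow> real \<Rightarrow> 'a" where
  "velocity I \<alpha> c s = vector_derivative (coord c \<circ> \<alpha>) (at s within I)"

text \<open>The covariant derivative of the velocity with respect to the ambient connection.\<close>

definition acceleration ::
  "('p, 'a::euclidean_space) connection \<Rightarrow> real set \<Rightarrow> (real \<Rightarrow> 'p) \<Rightarrow>
   ('p, 'a) chart \<Rightarrow> real \<Rightarrow> 'a" where
  "acceleration \<Gamma> I \<alpha> c s =
     vector_derivative (velocity I \<alpha> c) (at s within I) +
     \<Gamma> c (\<alpha> s) (velocity I \<alpha> c s) (velocity I \<alpha> c s)"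

text \<open>The induced connection on the hypersurface is the tangential component of the ambient
  connection, and \<open>v - \<eta> \<langle>v, \<xi>\<rangle> \<xi>\<close> is the tangential component of \<open>v\<close>.\<close>

definition induced_acceleration ::
  "('p, 'a::euclidean_space) metric \<Rightarrow> ('p, 'a) connection \<Rightarrow> ('p, 'a) vector_field \<Rightarrow> real \<Rightarrow>
   real set \<Rightarrow> (real \<Rightarrow> 'p) \<Rightarrow> ('p, 'a) chart \<Rightarrow> real \<Rightarrow> 'a" where
  "induced_acceleration g \<Gamma> \<xi> \<eta> I \<alpha> c s =
     acceleration \<Gamma> I \<alpha> c s -
     (\<eta> * g c (\<alpha> s) (acceleration \<Gamma> I \<alpha> c s) (\<xi> c (\<alpha> s))) *\<^sub>R \<xi> c (\<alpha> s)"

definition unit_speed ::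
  "('p, 'a::euclidean_space) chart set \<Rightarrow> ('p, 'a) metric \<Rightarrow> real set \<Rightarrow> (real \<Rightarrow> 'p) \<Rightarrow> bool" where
  "unit_speed A g I \<alpha> \<longleftrightarrow>
     (\<exists>\<epsilon>\<in>{1, -1}. \<forall>s\<in>I. \<forall>c\<in>A. \<alpha> s \<in> cdom c \<longrightarrow>
        g c (\<alpha> s) (velocity I \<alpha> c s) (velocity I \<alpha> c s) = \<epsilon>)"

definition geodesic_of_hypersurface ::
  "('p, 'a::euclidean_space) chart set \<Rightarrow> ('p, 'a) metric \<Rightarrow> ('p, 'a) connection \<Rightarrow>
   ('p, 'a) vector_field \<Rightarrow> real \<Rightarrow> real set \<Rightarrow> (real \<Rightarrow> 'p) \<Rightarrow> bool" where
  "geodesic_of_hypersurface A g \<Gamma> \<xi> \<eta> I \<alpha> \<longleftrightarrow>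
     (\<forall>s\<in>I. \<forall>c\<in>A. \<alpha> s \<in> cdom c \<longrightarrow> induced_acceleration g \<Gamma> \<xi> \<eta> I \<alpha> c s = 0)"

end

theory Submission
  imports Defs
begin

text \<open>For a unit speed curve in the hypersurface the normal part of the acceleration is
  \<open>\<eta> \<langle>S \<alpha>', \<alpha>'\<rangle> \<xi>\<close>, so \<open>\<langle>\<alpha>'', \<alpha>''\<rangle> = \<langle>a, a\<rangle> + \<eta> \<langle>S \<alpha>', \<alpha>'\<rangle>\<^sup>2\<close> where \<open>a\<close> is the
  intrinsic acceleration. If \<open>S = \<kappa> I\<close> the last term is \<open>\<eta> H\<^sup>2\<close>, and the claim reduces to the sign
  of \<open>\<langle>a, a\<rangle>\<close>. Conversely, every unit tangent vector \<open>u\<close> is the velocity of a unit speed curve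
  with \<open>a = 0\<close> at that point, which forces \<open>\<langle>S u, u\<rangle>\<^sup>2 = H\<^sup>2\<close>; the polynomial identity
  \<open>\<langle>S u, u\<rangle>\<^sup>2 = H\<^sup>2 \<langle>u, u\<rangle>\<^sup>2\<close> then factors, and since \<open>S\<close> is self-adjoint it is \<open>H\<close> or \<open>-H\<close> times
  the identity.\<close>

section \<open>Quadratic forms and self-adjoint operators\<close>

text \<open>The converse has two obstacles. The identity between squares fixes
  \<open>\<langle>S u, u\<rangle>\<close> only up to a sign that might change with \<open>u\<close>,
  and in an indefinite metric only non-null vectors can be normalized. Both are met by restricting
  quadratic forms to lines: each becomes a polynomial of degree at most 2 in one variable, with
  finitely many zeros unless it vanishes identically. The same device carries umbilicity from
  non-null vectors to all vectors.

  The test curves need vanishing intrinsic acceleration at one parameter only. There the zero vector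
  is neither timelike nor spacelike, so both inequalities apply and give equality. No geodesic has
  to be produced: a parabola in coordinates has the right acceleration, and the only differential
  equation left is the scalar one for arc length.

  In the last claim, equality yields just \<open>\<langle>a, a\<rangle> = 0\<close>. This leaves a
  lightlike \<open>a\<close> possible, which is why that claim concerns curves whose intrinsic
  acceleration is nowhere lightlike.\<close>

lemma bilinear_diag_zero:
  fixes b :: "'v::real_vector \<Rightarrow> 'v \<Rightarrow> real"
  assumes "bilinear b" and "\<And>u v. b u v = b v u" and "\<And>u. b u u = 0"
  shows "b u v = 0"
proof -
  have "b (u + v) (u + v) = b u u + 2 * b u v + b v v"
    using assms(2)[of v u] by (simp add: bilinear_ladd[OF assms(1)] bilinear_radd[OF assms(1)])
  then show ?thesis by (simp add: assms(3))
qed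

lemma bilinear_on_line:
  fixes b :: "'v::real_vector \<Rightarrow> 'v \<Rightarrow> real"
  assumes "bilinear b"
  shows "b (a + t *\<^sub>R d) (a + t *\<^sub>R d) = b a a + t * (b a d + b d a) + t\<^sup>2 * b d d"
  by (simp add: bilinear_ladd[OF assms] bilinear_radd[OF assms] bilinear_lmul[OF assms]
      bilinear_rmul[OF assms] power2_eq_square algebra_simps)

text \<open>On the line the form is a quadratic polynomial in \<open>t\<close> with constant
  coefficient \<open>b a a\<close> and leading coefficient \<open>b d d\<close>; one of them being
  nonzero makes it a nonzero polynomial.\<close>

lemma finite_zeros_on_line:
  fixes b :: "'v::real_vector \<Rightarrow> 'v \<Rightarrow> real"
  assumes "bilinear b" and "b a a \<noteq> 0 \<or> b d d \<noteq> 0"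
  shows "finite {t. b (a + t *\<^sub>R d) (a + t *\<^sub>R d) = 0}"
proof -
  let ?p = "[:b a a, b a d + b d a, b d d:]"
  have "?p \<noteq> 0" using assms(2) by simp
  moreover have "b (a + t *\<^sub>R d) (a + t *\<^sub>R d) = poly ?p t" for t
    by (simp add: bilinear_on_line[OF assms(1)] power2_eq_square algebra_simps)
  ultimately show ?thesis using poly_roots_finite[of ?p] by (simp only: not_False_eq_True)
qed

text \<open>The absence of zero divisors, in the form used here: a product of quadratic forms, none
  identically zero, is not identically zero. In the induction step \<open>a\<close> serves the old
  forms and \<open>d\<close> the new one. On the line from \<open>a\<close> in direction
  \<open>d\<close>, the old forms have nonzero constant coefficient and the new one nonzero leading
  coefficient, so all but finitely many \<open>t\<close> serve them all.\<close>

lemma common_nonzero_vector: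
  fixes F :: "('v::real_vector \<Rightarrow> 'v \<Rightarrow> real) set"
  assumes "finite F" and "\<And>b. b \<in> F \<Longrightarrow> bilinear b" and "\<And>b. b \<in> F \<Longrightarrow> \<exists>u. b u u \<noteq> 0"
  shows "\<exists>u. \<forall>b\<in>F. b u u \<noteq> 0"
  using assms
proof (induction F)
  case empty
  then show ?case by simp
next
  case (insert b F)
  then obtain a where a: "\<forall>b\<in>F. b a a \<noteq> 0" by auto
  obtain d where d: "b d d \<noteq> 0" using insert.prems by auto
  have fin: "finite (\<Union>c\<in>insert b F. {t. c (a + t *\<^sub>R d) (a + t *\<^sub>R d) = 0})"
  proof (rule finite_UN_I)
    show "finite (insert b F)" using insert.hyps by simp
    show "finite {t. c (a + t *\<^sub>R d) (a + t *\<^sub>R d) = 0}" if "c \<in> insert b F" for c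
      using finite_zeros_on_line[OF insert.prems(1)[OF that]] a d that by blast
  qed
  then obtain t where "t \<notin> (\<Union>c\<in>insert b F. {t. c (a + t *\<^sub>R d) (a + t *\<^sub>R d) = 0})"
    using ex_new_if_finite[OF infinite_UNIV_char_0 fin] by blast
  then show ?case by auto
qed

lemma nondegenerate_nonnull:
  assumes "bilinear b" and "\<And>u v. b u v = b v u" and "nondegenerate b" and "w \<noteq> 0"
  shows "\<exists>u. b u u \<noteq> 0"
  using bilinear_diag_zero[OF assms(1,2)] assms(3,4) unfolding nondegenerate_def by blast

text \<open>Fix a non-null \<open>e\<close> with eigenvalue \<open>k\<close>. Almost every
  \<open>v + t *\<^sub>R e\<close> is non-null. If \<open>v\<close> is non-null too, comparing the
  eigenvalues of \<open>e\<close>, \<open>v\<close> and \<open>v + t *\<^sub>R e\<close> forces the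
  value \<open>k\<close>; a null \<open>v\<close> is then a difference of two vectors already
  treated. This bridges the definition of umbilicity, which tests non-lightlike vectors only, and
  the statement that the shape operator is a multiple of the identity.\<close>

lemma scalar_if_nonnull_eigenvectors:
  fixes b :: "'v::euclidean_space \<Rightarrow> 'v \<Rightarrow> real" and L :: "'v \<Rightarrow> 'v"
  assumes b: "bilinear b" "\<And>u v. b u v = b v u" "nondegenerate b" and L: "linear L"
    and eig: "\<And>u. b u u \<noteq> 0 \<Longrightarrow> \<exists>k. L u = k *\<^sub>R u"
  shows "\<exists>k. \<forall>u. L u = k *\<^sub>R u"
proof -
  interpret L: linear L by (rule L)
  obtain w :: 'v where "w \<noteq> 0" using nonempty_Basis nonzero_Basis by blast
  then obtain e where e: "b e e \<noteq> 0" using nondegenerate_nonnull[OF b] by blast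
  then obtain k where k: "L e = k *\<^sub>R e" using eig by blast
  have step: "\<exists>t. t \<noteq> 0 \<and> b (v + t *\<^sub>R e) (v + t *\<^sub>R e) \<noteq> 0" for v
  proof -
    have fin: "finite (insert 0 {t. b (v + t *\<^sub>R e) (v + t *\<^sub>R e) = 0})"
      using finite_zeros_on_line[OF b(1)] e by blast
    then show ?thesis using ex_new_if_finite[OF infinite_UNIV_char_0 fin] by blast
  qed
  have nonnull: "L v = k *\<^sub>R v" if v: "b v v \<noteq> 0" for v
  proof -
    obtain l where l: "L v = l *\<^sub>R v" using eig v by blast
    obtain t where t: "t \<noteq> 0" "b (v + t *\<^sub>R e) (v + t *\<^sub>R e) \<noteq> 0" using step by blast
    then obtain m where "L (v + t *\<^sub>R e) = m *\<^sub>R (v + t *\<^sub>R e)" using eig by blast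
    then have "l *\<^sub>R v + t *\<^sub>R k *\<^sub>R e = m *\<^sub>R (v + t *\<^sub>R e)"
      by (simp add: L.add L.scale k l)
    then have eq: "(l - m) *\<^sub>R v = (t * (m - k)) *\<^sub>R e" by (simp add: algebra_simps)
    show ?thesis
    proof (cases "l = m")
      case True
      then have "(t * (m - k)) *\<^sub>R e = 0" using eq by simp
      moreover have "e \<noteq> 0" using e by (auto simp: bilinear_lzero[OF b(1)])
      ultimately have "m = k" using t by simp
      then show ?thesis using l True by simp
    next
      case False
      \<comment> \<open>Here \<open>v\<close> is a multiple of \<open>e\<close>, so it has the
        eigenvalue of \<open>e\<close>.\<close>
      have "v = (1 / (l - m)) *\<^sub>R (l - m) *\<^sub>R v" using False by simp
      then have "v = (t * (m - k) / (l - m)) *\<^sub>R e" by (simp only: eq) simp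
      then show ?thesis by (metis L.scale k scaleR_left_commute)
    qed
  qed
  have "L v = k *\<^sub>R v" for v
  proof -
    obtain t where t: "b (v + t *\<^sub>R e) (v + t *\<^sub>R e) \<noteq> 0" using step by blast
    have "L v + t *\<^sub>R k *\<^sub>R e = k *\<^sub>R (v + t *\<^sub>R e)"
      using nonnull[OF t] by (simp add: L.add L.scale k)
    then show ?thesis by (simp add: algebra_simps)
  qed
  then show ?thesis by blast
qed

text \<open>The quadratic form of \<open>L - h\<close> times that of \<open>L + h\<close> times that of \<open>b\<close> vanishes identically;
  polynomials have no zero divisors, so one factor does.\<close>

lemma scalar_if_constant_squared_form:
  fixes b :: "'v::euclidean_space \<Rightarrow> 'v \<Rightarrow> real" and L :: "'v \<Rightarrow> 'v"
  assumes b: "bilinear b" "\<And>u v. b u v = b v u" "nondegenerate b" and L: "linear L"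
    and self_adjoint: "\<And>u v. b (L u) v = b (L v) u"
    and sq: "\<And>u. b u u = 1 \<or> b u u = -1 \<Longrightarrow> (b (L u) u)\<^sup>2 = h\<^sup>2"
  shows "\<exists>k. \<forall>u. L u = k *\<^sub>R u"
proof -
  interpret L: linear L by (rule L)
  define q where "q k u v = b (L u - k *\<^sub>R u) v" for k u v
  note bs = bilinear_ladd[OF b(1)] bilinear_radd[OF b(1)] bilinear_lmul[OF b(1)]
    bilinear_rmul[OF b(1)] bilinear_lsub[OF b(1)]
  have q_bilinear: "bilinear (q k)" for k
    unfolding bilinear_def q_def
    by (auto intro!: linearI simp: bs L.add L.scale algebra_simps)
  \<comment> \<open>Self-adjointness of \<open>L\<close> makes \<open>q k\<close> symmetric, so by
    polarization a vanishing quadratic form means \<open>q k = 0\<close>, and nondegeneracy of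
    \<open>b\<close> turns this into \<open>L = k\<close>.\<close>
  have scalar: ?thesis if z: "\<And>u. q k u u = 0" for k
  proof -
    have "q k u v = q k v u" for u v
      using self_adjoint[of u v] b(2)[of u v] by (simp add: q_def bs)
    then have "q k u v = 0" for u v using bilinear_diag_zero[OF q_bilinear _ z] by blast
    then have "L u - k *\<^sub>R u = 0" for u using b(3) unfolding nondegenerate_def q_def by blast
    then show ?thesis by auto
  qed
  obtain w :: 'v where "w \<noteq> 0" using nonempty_Basis nonzero_Basis by blast
  then have b_nz: "\<exists>u. b u u \<noteq> 0" using nondegenerate_nonnull[OF b] by blast
  show ?thesis
  proof (rule ccontr)
    assume contr: "\<not> ?thesis"
    then have "\<exists>u. q k u u \<noteq> 0" for k using scalar by blast
    then obtain u where u: "b u u \<noteq> 0" "q h u u \<noteq> 0" "q (-h) u u \<noteq> 0"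
      using common_nonzero_vector[of "{b, q h, q (-h)}"] b(1) b_nz q_bilinear by auto
    \<comment> \<open>Rescaling by \<open>r\<close> moves \<open>u\<close> to
      \<open>b\<close>-square 1 or -1, where \<open>sq\<close> applies; both sides then scale by the
      fourth power of \<open>r\<close>, which cancels.\<close>
    define r where "r = 1 / sqrt \<bar>b u u\<bar>"
    have r: "r\<^sup>2 * \<bar>b u u\<bar> = 1" using u by (simp add: r_def power_divide)
    have "b (r *\<^sub>R u) (r *\<^sub>R u) = r\<^sup>2 * b u u" by (simp add: bs power2_eq_square)
    moreover have "r\<^sup>2 * b u u = 1 \<or> r\<^sup>2 * b u u = -1" using r by (cases "b u u \<ge> 0") auto
    ultimately have "(b (L (r *\<^sub>R u)) (r *\<^sub>R u))\<^sup>2 = h\<^sup>2" using sq by simp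
    then have *: "(r\<^sup>2 * b (L u) u)\<^sup>2 = h\<^sup>2" by (simp add: L.scale bs power2_eq_square)
    have "(r\<^sup>2)\<^sup>2 * (b (L u) u)\<^sup>2 = h\<^sup>2 * ((r\<^sup>2)\<^sup>2 * (b u u)\<^sup>2)"
    proof -
      have "(r\<^sup>2)\<^sup>2 * (b u u)\<^sup>2 = (r\<^sup>2 * \<bar>b u u\<bar>)\<^sup>2" by (simp add: power_mult_distrib)
      then show ?thesis using * r by (simp add: power_mult_distrib)
    qed
    moreover have "r \<noteq> 0" using r by auto
    ultimately have "(b (L u) u)\<^sup>2 = h\<^sup>2 * (b u u)\<^sup>2" by simp
    then have "(b (L u) u - h * b u u) * (b (L u) u + h * b u u) = 0"
      by (simp add: power2_eq_square algebra_simps)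
    then show False using u by (simp add: q_def bs)
  qed
qed

text \<open>A dimension count: the range of \<open>D\<close> lies in the kernel of \<open>f\<close>,
  which is a proper subspace because of \<open>x\<close>, and both have codimension one. With
  \<open>f\<close> the product with the unit normal, this identifies the tangent space with the
  vectors orthogonal to the normal.\<close>

lemma range_eq_hyperplane:
  fixes D :: "'b::euclidean_space \<Rightarrow> 'a::euclidean_space" and f :: "'a \<Rightarrow> real"
  assumes "linear D" "inj D" "linear f" "DIM('a) = DIM('b) + 1"
    and "\<And>u. f (D u) = 0" and "f x \<noteq> 0" and "f z = 0"
  shows "\<exists>w. D w = z"
proof -
  interpret f: linear f by fact
  let ?P = "{z. f z = 0}"
  have P: "subspace ?P" by (auto simp: subspace_def f.add f.scale)
  have R: "subspace (range D)" using assms(1) by (simp add: linear_subspace_image)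
  have "dim (range D) = DIM('b)" using assms(1,2) by (simp add: dim_image_eq inj_on_subset)
  moreover have "dim ?P \<noteq> DIM('a)"
    using dim_eq_full[of ?P] P assms(6) by (auto simp flip: span_eq_iff)
  then have "dim ?P \<le> DIM('b)" using dim_subset_UNIV[of ?P] assms(4) by linarith
  moreover have "range D \<subseteq> ?P" using assms(5) by auto
  ultimately have "range D = ?P" using subspace_dim_equal[OF R P] by simp
  then have "z \<in> range D" using assms(7) by simp
  then show ?thesis by auto
qed

section \<open>Derivatives of smooth maps\<close>

lemma linear_expand_Basis:
  fixes L :: "'a::euclidean_space \<Rightarrow> 'c::real_vector"
  assumes "linear L" shows "L v = (\<Sum>b\<in>Basis. (v \<bullet> b) *\<^sub>R L b)"
proof -
  interpret linear L by fact
  have "L (\<Sum>b\<in>Basis. (v \<bullet> b) *\<^sub>R b) = (\<Sum>b\<in>Basis. (v \<bullet> b) *\<^sub>R L b)"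
    by (simp add: sum scale)
  then show ?thesis by (simp add: euclidean_representation)
qed

lemma smooth_on_differentiable: "smooth_on f U \<Longrightarrow> f differentiable_on U"
  unfolding smooth_on_def using Ck_on.simps(2) by blast

lemma smooth_on_frechet: "smooth_on f U \<Longrightarrow> smooth_on (\<lambda>x. frechet_derivative f (at x) v) U"
  unfolding smooth_on_def using Ck_on.simps(2) by blast

lemma smooth_on_continuous: "smooth_on f U \<Longrightarrow> continuous_on U f"
  unfolding smooth_on_def using Ck_on.simps(1) by blast

lemma smooth_on_has_derivative:
  assumes "smooth_on f U" "open U" "x \<in> U"
  shows "(f has_derivative frechet_derivative f (at x)) (at x)"
  using assms smooth_on_differentiable differentiable_on_eq_differentiable_at frechet_derivative_works
  by blast

lemma smooth_on_frechet_linear: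
  assumes "smooth_on f U" "open U" "x \<in> U"
  shows "linear (frechet_derivative f (at x))"
  using smooth_on_has_derivative[OF assms] has_derivative_linear by blast

lemma has_vector_derivative_smooth_compose:
  assumes "smooth_on f U" "open U" "z s \<in> U" "(z has_vector_derivative z') (at s within J)"
  shows "((\<lambda>t. f (z t)) has_vector_derivative frechet_derivative f (at (z s)) z') (at s within J)"
proof -
  have "((\<lambda>t. f (z t)) has_derivative (\<lambda>h. frechet_derivative f (at (z s)) (h *\<^sub>R z'))) (at s within J)"
    using has_derivative_compose[OF assms(4)[unfolded has_vector_derivative_def]
        smooth_on_has_derivative[OF assms(1-3)]] .
  then show ?thesis
    using smooth_on_frechet_linear[OF assms(1-3)]
    by (simp add: has_vector_derivative_def linear_scale)
qed

text \<open>\<open>smooth_on\<close> controls a differential only with a constant vector inserted,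
  and the metric is likewise smooth for constant arguments. Expanding the varying argument in
  \<open>Basis\<close> reduces the product rule to that case.\<close>

lemma has_derivative_linear_family:
  fixes M :: "'x::real_normed_vector \<Rightarrow> 'a::euclidean_space \<Rightarrow> 'c::real_normed_vector"
  assumes x: "x \<in> S" and lin: "\<And>y. y \<in> S \<Longrightarrow> linear (M y)"
    and M': "\<And>b. ((\<lambda>y. M y b) has_derivative (\<lambda>h. M' h b)) (at x within S)"
    and lin': "\<And>h. linear (M' h)"
    and A: "(A has_derivative A') (at x within S)"
  shows "((\<lambda>y. M y (A y)) has_derivative (\<lambda>h. M' h (A x) + M x (A' h))) (at x within S)"
proof -
  have "((\<lambda>y. \<Sum>b\<in>Basis. (A y \<bullet> b) *\<^sub>R M y b) has_derivative
      (\<lambda>h. \<Sum>b\<in>Basis. (A x \<bullet> b) *\<^sub>R M' h b + (A' h \<bullet> b) *\<^sub>R M x b)) (at x within S)"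
    by (rule has_derivative_sum has_derivative_scaleR has_derivative_inner_left A M')+
  moreover have "(\<lambda>h. \<Sum>b\<in>Basis. (A x \<bullet> b) *\<^sub>R M' h b + (A' h \<bullet> b) *\<^sub>R M x b)
      = (\<lambda>h. M' h (A x) + M x (A' h))"
    by (simp only: linear_expand_Basis[OF lin', of _ "A x"] linear_expand_Basis[OF lin[OF x], of "A' _"] sum.distrib)
  ultimately have "((\<lambda>y. \<Sum>b\<in>Basis. (A y \<bullet> b) *\<^sub>R M y b) has_derivative
      (\<lambda>h. M' h (A x) + M x (A' h))) (at x within S)" by simp
  then show ?thesis using linear_expand_Basis[OF lin] by (rule has_derivative_transform[OF x, rotated])
qed

lemma has_derivative_bilinear_family:
  fixes G :: "'x::real_normed_vector \<Rightarrow> 'a::euclidean_space \<Rightarrow> 'b::euclidean_space \<Rightarrow> 'c::real_normed_vector"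
  assumes x: "x \<in> S" and bil: "\<And>y. y \<in> S \<Longrightarrow> bilinear (G y)"
    and G': "\<And>u v. ((\<lambda>y. G y u v) has_derivative (\<lambda>h. G' h u v)) (at x within S)"
    and bil': "\<And>h. bilinear (G' h)"
    and A: "(A has_derivative A') (at x within S)"
    and B: "(B has_derivative B') (at x within S)"
  shows "((\<lambda>y. G y (A y) (B y)) has_derivative
      (\<lambda>h. G' h (A x) (B x) + G x (A' h) (B x) + G x (A x) (B' h))) (at x within S)"
proof -
  have B_lin: "linear B'" using B has_derivative_linear by blast
  have "((\<lambda>y. G y u (B y)) has_derivative (\<lambda>h. G' h u (B x) + G x u (B' h))) (at x within S)" for u
    using bil bil' by (intro has_derivative_linear_family x G' B) (auto simp: bilinear_def)
  then have "((\<lambda>y. G y (A y) (B y)) has_derivative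
      (\<lambda>h. (G' h (A x) (B x) + G x (A x) (B' h)) + G x (A' h) (B x))) (at x within S)"
    using bil bil' x
    by (intro has_derivative_linear_family[where M = "\<lambda>y u. G y u (B y)"
          and M' = "\<lambda>h u. G' h u (B x) + G x u (B' h)"] A linear_compose_add) (auto simp: bilinear_def)
  then show ?thesis by (simp add: algebra_simps)
qed

text \<open>The mean value theorem is used twice: in direction \<open>u\<close> for the increment of
  \<open>f\<close> over \<open>h *\<^sub>R v\<close>, then in direction \<open>v\<close> for
  \<open>D _ u\<close>. The left-hand side is symmetric in \<open>u\<close> and \<open>v\<close>,
  while the right-hand side differentiates along \<open>u\<close> first.\<close>

lemma mean_value_mixed_difference:
  fixes f :: "'a::real_normed_vector \<Rightarrow> real"
  assumes h: "0 < h" and box: "\<And>s t. \<lbrakk>0 \<le> s; s \<le> h; 0 \<le> t; t \<le> h\<rbrakk> \<Longrightarrow> x + s *\<^sub>R u + t *\<^sub>R v \<in> U"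
    and D: "\<And>y. y \<in> U \<Longrightarrow> (f has_derivative D y) (at y)"
    and E: "\<And>y. y \<in> U \<Longrightarrow> ((\<lambda>y. D y u) has_derivative E y) (at y)"
  shows "\<exists>s t. 0 < s \<and> s < h \<and> 0 < t \<and> t < h \<and>
    f (x + h *\<^sub>R u + h *\<^sub>R v) - f (x + h *\<^sub>R u) - f (x + h *\<^sub>R v) + f x
      = h\<^sup>2 * E (x + s *\<^sub>R u + t *\<^sub>R v) v"
proof -
  define a where "a s = f (x + s *\<^sub>R u + h *\<^sub>R v) - f (x + s *\<^sub>R u)" for s
  have f_der: "((\<lambda>s. f (x + s *\<^sub>R u + t *\<^sub>R v)) has_real_derivative D (x + s *\<^sub>R u + t *\<^sub>R v) u) (at s)"
    if "0 \<le> s" "s \<le> h" "0 \<le> t" "t \<le> h" for s t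
  proof -
    have d: "((\<lambda>s. x + s *\<^sub>R u + t *\<^sub>R v) has_derivative (\<lambda>r. r *\<^sub>R u)) (at s)"
      by (auto intro!: derivative_eq_intros)
    have D1: "(f has_derivative D (x + s *\<^sub>R u + t *\<^sub>R v)) (at (x + s *\<^sub>R u + t *\<^sub>R v))"
      using D box that by blast
    show ?thesis
      using has_derivative_compose[OF d D1] linear_scale[OF has_derivative_linear[OF D1]]
      by (simp add: has_field_derivative_def mult.commute[of _ "D _ _"] mult_commute_abs)
  qed
  have a_der: "(a has_real_derivative D (x + s *\<^sub>R u + h *\<^sub>R v) u - D (x + s *\<^sub>R u) u) (at s)"
    if "0 \<le> s" "s \<le> h" for s
    unfolding a_def using f_der[of s h] f_der[of s 0] that h by (auto intro!: DERIV_diff)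
  obtain s where s: "0 < s" "s < h"
      "a h - a 0 = h * (D (x + s *\<^sub>R u + h *\<^sub>R v) u - D (x + s *\<^sub>R u) u)"
    using MVT2[OF h a_der] by auto
  have b_der: "((\<lambda>t. D (x + s *\<^sub>R u + t *\<^sub>R v) u) has_real_derivative E (x + s *\<^sub>R u + t *\<^sub>R v) v) (at t)"
    if "0 \<le> t" "t \<le> h" for t
  proof -
    have d: "((\<lambda>t. x + s *\<^sub>R u + t *\<^sub>R v) has_derivative (\<lambda>r. r *\<^sub>R v)) (at t)"
      by (auto intro!: derivative_eq_intros)
    have E1: "((\<lambda>y. D y u) has_derivative E (x + s *\<^sub>R u + t *\<^sub>R v)) (at (x + s *\<^sub>R u + t *\<^sub>R v))"
      using E box s that by simp
    show ?thesis
      using has_derivative_compose[OF d E1] linear_scale[OF has_derivative_linear[OF E1]]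
      by (simp add: has_field_derivative_def mult_commute_abs)
  qed
  obtain t where t: "0 < t" "t < h"
      "D (x + s *\<^sub>R u + h *\<^sub>R v) u - D (x + s *\<^sub>R u + 0 *\<^sub>R v) u = (h - 0) * E (x + s *\<^sub>R u + t *\<^sub>R v) v"
    using MVT2[OF h b_der] by blast
  have "f (x + h *\<^sub>R u + h *\<^sub>R v) - f (x + h *\<^sub>R u) - f (x + h *\<^sub>R v) + f x = a h - a 0"
    by (simp add: a_def)
  also have "\<dots> = h\<^sup>2 * E (x + s *\<^sub>R u + t *\<^sub>R v) v"
    using s(3) t(3) by (simp add: power2_eq_square)
  finally show ?thesis using s t by blast
qed

text \<open>Schwarz's theorem. Computing the same second difference in both orders gives a value of
  \<open>E u _ v\<close> equal to a value of \<open>E v _ u\<close>, at two points near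
  \<open>x\<close>; by continuity each differs from the value at \<open>x\<close> by less than half
  the supposed gap.\<close>

lemma symmetric_mixed_derivative:
  fixes f :: "'a::real_normed_vector \<Rightarrow> real"
  assumes U: "open U" "x \<in> U"
    and D: "\<And>y. y \<in> U \<Longrightarrow> (f has_derivative D y) (at y)"
    and E: "\<And>y w. y \<in> U \<Longrightarrow> ((\<lambda>y. D y w) has_derivative E w y) (at y)"
    and cont: "\<And>w w'. continuous_on U (\<lambda>y. E w y w')"
  shows "E u x v = E v x u"
proof (rule ccontr)
  assume ne: "E u x v \<noteq> E v x u"
  define e where "e = \<bar>E u x v - E v x u\<bar> / 2"
  have e: "e > 0" using ne by (simp add: e_def)
  have isCont: "isCont (\<lambda>y. E w y w') x" for w w'
    using cont U by (simp add: continuous_on_eq_continuous_at)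
  obtain d1 where d1: "d1 > 0" "\<And>y. dist y x < d1 \<Longrightarrow> \<bar>E u y v - E u x v\<bar> < e"
    using isCont[of u v] e unfolding continuous_at_eps_delta dist_real_def by blast
  obtain d2 where d2: "d2 > 0" "\<And>y. dist y x < d2 \<Longrightarrow> \<bar>E v y u - E v x u\<bar> < e"
    using isCont[of v u] e unfolding continuous_at_eps_delta dist_real_def by blast
  obtain d3 where d3: "d3 > 0" "ball x d3 \<subseteq> U" using U open_contains_ball by blast
  define d where "d = min d1 (min d2 d3)"
  have d: "d > 0" using d1 d2 d3 by (simp add: d_def)
  \<comment> \<open>The scale is such that every point
    \<open>x + s *\<^sub>R u + t *\<^sub>R v\<close> with \<open>s\<close>, \<open>t\<close> in
    \<open>[0, h]\<close> is closer than \<open>d\<close> to \<open>x\<close>; the summand 1 makes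
    the bound strict and covers \<open>u = v = 0\<close>.\<close>
  define h where "h = d / (norm u + norm v + 1)"
  have pos: "norm u + norm v + 1 > 0" using norm_ge_zero[of u] norm_ge_zero[of v] by linarith
  have h: "h > 0" using d pos by (simp add: h_def)
  have close: "dist (x + s *\<^sub>R a + t *\<^sub>R b) x < d"
    if "0 \<le> s" "s \<le> h" "0 \<le> t" "t \<le> h" "norm a + norm b = norm u + norm v" for s t a b
  proof -
    have "dist (x + s *\<^sub>R a + t *\<^sub>R b) x \<le> norm (s *\<^sub>R a) + norm (t *\<^sub>R b)"
      by (simp add: dist_norm add.assoc norm_triangle_ineq del: norm_scaleR)
    also have "\<dots> \<le> h * norm a + h * norm b"
      using that by (intro add_mono) (simp_all add: mult_right_mono)
    also have "\<dots> = h * (norm u + norm v)" using that(5) by (simp flip: distrib_left)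
    also have "\<dots> < h * (norm u + norm v + 1)" using h by simp
    also have "\<dots> = d" using pos by (simp add: h_def)
    finally show ?thesis .
  qed
  have inU: "x + s *\<^sub>R a + t *\<^sub>R b \<in> U"
    if "0 \<le> s" "s \<le> h" "0 \<le> t" "t \<le> h" "norm a + norm b = norm u + norm v" for s t a b
    using close[OF that] d3(2) by (auto simp: d_def dist_commute)
  obtain s t where st: "0 < s" "s < h" "0 < t" "t < h"
    "f (x + h *\<^sub>R u + h *\<^sub>R v) - f (x + h *\<^sub>R u) - f (x + h *\<^sub>R v) + f x
      = h\<^sup>2 * E u (x + s *\<^sub>R u + t *\<^sub>R v) v"
    using mean_value_mixed_difference[OF h inU D E, of u v] by blast
  obtain s' t' where st': "0 < s'" "s' < h" "0 < t'" "t' < h"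
    "f (x + h *\<^sub>R v + h *\<^sub>R u) - f (x + h *\<^sub>R v) - f (x + h *\<^sub>R u) + f x
      = h\<^sup>2 * E v (x + s' *\<^sub>R v + t' *\<^sub>R u) u"
    using mean_value_mixed_difference[OF h inU D E, of v u] by (auto simp: add.commute[of "norm v"])
  have "h\<^sup>2 * E u (x + s *\<^sub>R u + t *\<^sub>R v) v = h\<^sup>2 * E v (x + s' *\<^sub>R v + t' *\<^sub>R u) u"
    using st(5) st'(5) by (simp add: algebra_simps)
  then have "E u (x + s *\<^sub>R u + t *\<^sub>R v) v = E v (x + s' *\<^sub>R v + t' *\<^sub>R u) u" using h by simp
  moreover have "\<bar>E u (x + s *\<^sub>R u + t *\<^sub>R v) v - E u x v\<bar> < e"
    using d1(2) close[of s t u v] st by (simp add: d_def)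
  moreover have "\<bar>E v (x + s' *\<^sub>R v + t' *\<^sub>R u) u - E v x u\<bar> < e"
    using d2(2) close[of s' t' v u] st' by (simp add: d_def add.commute)
  ultimately have "\<bar>E u x v - E v x u\<bar> < e + e" unfolding abs_less_iff by linarith
  then show False by (simp add: e_def)
qed

text \<open>For the inclusion in coordinates, this symmetry is half of the reason why the shape
  operator is self-adjoint.\<close>

lemma smooth_on_second_derivative_symmetric:
  fixes f :: "'a::euclidean_space \<Rightarrow> 'b::euclidean_space"
  assumes f: "smooth_on f U" and U: "open U" "x \<in> U"
  shows "frechet_derivative (\<lambda>y. frechet_derivative f (at y) u) (at x) v
       = frechet_derivative (\<lambda>y. frechet_derivative f (at y) v) (at x) u"
proof (rule euclidean_eqI)
  fix b :: 'b assume "b \<in> Basis"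
  let ?D = "\<lambda>y w. frechet_derivative f (at y) w"
  let ?E = "\<lambda>w y. frechet_derivative (\<lambda>y. ?D y w) (at y)"
  show "?E u x v \<bullet> b = ?E v x u \<bullet> b"
  proof (rule symmetric_mixed_derivative[OF U, where f = "\<lambda>y. f y \<bullet> b"
        and D = "\<lambda>y w. ?D y w \<bullet> b" and E = "\<lambda>w y w'. ?E w y w' \<bullet> b"])
    show "continuous_on U (\<lambda>y. ?E w y w' \<bullet> b)" for w w'
      by (intro continuous_on_inner continuous_on_const smooth_on_continuous smooth_on_frechet f)
  qed (auto intro!: has_derivative_inner_left smooth_on_has_derivative[of _ U] smooth_on_frechet f U)
qed

section \<open>Curves\<close>

text \<open>By separation of variables: \<open>\<tau>\<close> is the inverse of an antiderivative of \<open>1/\<phi>\<close>.\<close>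

lemma autonomous_ode_local_solution:
  fixes \<phi> :: "real \<Rightarrow> real"
  assumes r: "0 < r" and cont: "continuous_on {-r..r} \<phi>" and pos: "\<And>t. t \<in> {-r..r} \<Longrightarrow> 0 < \<phi> t"
  shows "\<exists>\<delta>>0. \<exists>\<tau>. \<tau> 0 = 0 \<and>
    (\<forall>s\<in>{-\<delta><..<\<delta>}. \<tau> s \<in> {-r<..<r} \<and> (\<tau> has_real_derivative \<phi> (\<tau> s)) (at s))"
proof -
  have "continuous_on {-r..r} (\<lambda>t. 1 / \<phi> t)"
    using cont pos by (intro continuous_intros) fastforce+
  then obtain L0 where L0: "\<And>t. t \<in> {-r..r} \<Longrightarrow> (L0 has_vector_derivative 1 / \<phi> t) (at t within {-r..r})"
    using antiderivative_continuous by blast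
  define L where "L t = L0 t - L0 0" for t
  have L_within: "(L has_vector_derivative 1 / \<phi> t) (at t within {-r..r})" if "t \<in> {-r..r}" for t
    unfolding L_def using has_vector_derivative_diff[OF L0[OF that] has_vector_derivative_const] by simp
  have L_cont: "continuous_on {-r..r} L"
    using L_within by (meson continuous_on_eq_continuous_within has_vector_derivative_continuous)
  have L_der: "(L has_real_derivative 1 / \<phi> t) (at t)" if "t \<in> {-r<..<r}" for t
    using L_within[of t] that by (simp add: has_real_derivative_iff_has_vector_derivative at_within_Icc_at)
  have mono: "L a < L b" if "-r \<le> a" "a < b" "b \<le> r" for a b
  proof (rule DERIV_pos_imp_increasing_open[OF that(2)])
    show "\<exists>y. (L has_real_derivative y) (at x) \<and> 0 < y" if "a < x" "x < b" for x
      using L_der[of x] pos[of x] that \<open>-r \<le> a\<close> \<open>b \<le> r\<close> by auto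
    show "continuous_on {a..b} L" using continuous_on_subset[OF L_cont] that by auto
  qed
  have inj: "inj_on L {-r..r}"
    by (rule linorder_inj_onI) (use mono in force)+
  have L_mono: "L a \<le> L b" if "-r \<le> a" "a \<le> b" "b \<le> r" for a b
    using mono[of a b] that by (cases "a = b") auto
  define \<tau> where "\<tau> = inv_into {-r..r} L"
  have L_0: "L 0 = 0" by (simp add: L_def)
  \<comment> \<open>\<open>L\<close> increases from a negative value at \<open>-r\<close> through 0
    to a positive value at \<open>r\<close>, so on this interval its inverse is defined and stays
    away from both endpoints.\<close>
  define \<delta> where "\<delta> = min (- L (-r)) (L r)"
  have \<delta>: "\<delta> > 0" using mono[of "-r" 0] mono[of 0 r] r by (simp add: \<delta>_def L_0)
  have \<tau>: "\<tau> s \<in> {-r<..<r} \<and> L (\<tau> s) = s" if "s \<in> {-\<delta><..<\<delta>}" for s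
  proof -
    have s: "L (-r) < s" "s < L r" using that by (auto simp: \<delta>_def)
    obtain t where t: "-r \<le> t" "t \<le> r" "L t = s"
      using IVT'[of L "-r" s r] s L_cont r by auto
    then have "t \<in> {-r<..<r}" using s by (cases "t = r"; cases "t = -r") auto
    moreover have "\<tau> s = t" using t inj by (auto simp: \<tau>_def intro!: inv_into_f_eq)
    ultimately show ?thesis using t by simp
  qed
  have "continuous_on (L ` {-r..r}) \<tau>"
    by (rule continuous_on_inv[OF L_cont]) (use inj in \<open>auto simp: \<tau>_def\<close>)
  moreover have "{-\<delta><..<\<delta>} \<subseteq> L ` {-r..r}"
  proof
    fix s assume "s \<in> {-\<delta><..<\<delta>}"
    then show "s \<in> L ` {-r..r}" using \<tau>[of s] by (intro image_eqI[of _ _ "\<tau> s"]) auto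
  qed
  ultimately have "continuous_on {-\<delta><..<\<delta>} \<tau>" by (rule continuous_on_subset)
  then have \<tau>_cont: "isCont \<tau> s" if "s \<in> {-\<delta><..<\<delta>}" for s
    using that by (simp add: continuous_on_eq_continuous_at)
  have \<tau>_der: "(\<tau> has_real_derivative \<phi> (\<tau> s)) (at s)" if "s \<in> {-\<delta><..<\<delta>}" for s
  proof -
    have "1 / \<phi> (\<tau> s) \<noteq> 0" using pos[of "\<tau> s"] \<tau>[OF that] by simp
    then have "(\<tau> has_real_derivative inverse (1 / \<phi> (\<tau> s))) (at s)"
      using that \<tau> by (intro DERIV_inverse_function[where f = L and a = "-\<delta>" and b = \<delta>] L_der \<tau>_cont) auto
    then show ?thesis by simp
  qed
  have "\<tau> 0 = 0" unfolding \<tau>_def using inj r L_0 by (intro inv_into_f_eq) auto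
  then show ?thesis using \<delta> \<tau> \<tau>_der by blast
qed

text \<open>The format is that of \<open>C2_on\<close>, one order lower and with the same one-sided
  convention. Class C^2 thus splits into a derivative of class C^1, and closure under sums, products
  and compositions is settled at order one.\<close>

definition C1_on :: "(real \<Rightarrow> 'a::real_normed_vector) \<Rightarrow> real set \<Rightarrow> bool" where
  "C1_on f J \<longleftrightarrow> (\<exists>f'. (\<forall>s\<in>J. (f has_vector_derivative f' s) (at s within J)) \<and> continuous_on J f')"

lemma C1_onI:
  "(\<And>s. s \<in> J \<Longrightarrow> (f has_vector_derivative f' s) (at s within J)) \<Longrightarrow> continuous_on J f' \<Longrightarrow> C1_on f J"
  unfolding C1_on_def by blast

lemma C2_on_iff_C1_on:
  "C2_on f J \<longleftrightarrow> (\<exists>f'. (\<forall>s\<in>J. (f has_vector_derivative f' s) (at s within J)) \<and> C1_on f' J)"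
  unfolding C2_on_def C1_on_def by blast

lemma C1_on_continuous: "C1_on f J \<Longrightarrow> continuous_on J f"
  unfolding C1_on_def
  by (meson continuous_on_eq_continuous_within has_vector_derivative_continuous)

lemma C1_on_subset: "C1_on f J \<Longrightarrow> I \<subseteq> J \<Longrightarrow> C1_on f I"
  unfolding C1_on_def
  by (meson continuous_on_subset has_vector_derivative_within_subset subsetD)

lemma C1_on_eq: "C1_on f J \<Longrightarrow> (\<And>s. s \<in> J \<Longrightarrow> f s = h s) \<Longrightarrow> C1_on h J"
  unfolding C1_on_def using has_vector_derivative_transform by metis

lemma C1_on_const: "C1_on (\<lambda>s. a) J"
  unfolding C1_on_def by (intro exI[of _ "\<lambda>s. 0"]) auto

lemma C1_on_id: "C1_on (\<lambda>s. s) J"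
  unfolding C1_on_def by (intro exI[of _ "\<lambda>s. 1"]) (auto intro: has_vector_derivative_id)

lemma C1_on_add:
  assumes "C1_on f J" "C1_on h J" shows "C1_on (\<lambda>s. f s + h s) J"
proof -
  obtain f' h' where "\<forall>s\<in>J. (f has_vector_derivative f' s) (at s within J)" "continuous_on J f'"
    "\<forall>s\<in>J. (h has_vector_derivative h' s) (at s within J)" "continuous_on J h'"
    using assms unfolding C1_on_def by blast
  then show ?thesis unfolding C1_on_def
    by (intro exI[of _ "\<lambda>s. f' s + h' s"]) (auto intro!: has_vector_derivative_add continuous_on_add)
qed

lemma C1_on_sum: "(\<And>i. i \<in> X \<Longrightarrow> C1_on (f i) J) \<Longrightarrow> C1_on (\<lambda>s. \<Sum>i\<in>X. f i s) J"
  by (induction X rule: infinite_finite_induct) (auto intro: C1_on_add C1_on_const)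

lemma C1_on_scaleR:
  assumes "C1_on f J" "C1_on h J" shows "C1_on (\<lambda>s. f s *\<^sub>R h s) J"
proof -
  obtain f' h' where *: "\<forall>s\<in>J. (f has_vector_derivative f' s) (at s within J)" "continuous_on J f'"
    "\<forall>s\<in>J. (h has_vector_derivative h' s) (at s within J)" "continuous_on J h'"
    using assms unfolding C1_on_def by blast
  show ?thesis unfolding C1_on_def
    using * C1_on_continuous[OF assms(1)] C1_on_continuous[OF assms(2)]
    by (intro exI[of _ "\<lambda>s. f s *\<^sub>R h' s + f' s *\<^sub>R h s"])
       (auto intro!: has_vector_derivative_scaleR continuous_intros
         simp: has_real_derivative_iff_has_vector_derivative)
qed

lemma C1_on_inner_left:
  assumes "C1_on f J" shows "C1_on (\<lambda>s. f s \<bullet> b) J"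
proof -
  obtain f' where "\<forall>s\<in>J. (f has_vector_derivative f' s) (at s within J)" "continuous_on J f'"
    using assms unfolding C1_on_def by blast
  then show ?thesis unfolding C1_on_def
    by (intro exI[of _ "\<lambda>s. f' s \<bullet> b"])
       (auto intro!: bounded_linear.has_vector_derivative[OF bounded_linear_inner_left] continuous_intros)
qed

lemma C1_on_smooth_compose:
  assumes f: "smooth_on f U" "open U" and z: "C1_on z J" "\<And>s. s \<in> J \<Longrightarrow> z s \<in> U"
  shows "C1_on (\<lambda>s. f (z s)) J"
proof -
  obtain z' where z': "\<And>s. s \<in> J \<Longrightarrow> (z has_vector_derivative z' s) (at s within J)" "continuous_on J z'"
    using z unfolding C1_on_def by blast
  let ?D = "\<lambda>x. frechet_derivative f (at x)"
  have "continuous_on J (\<lambda>s. ?D (z s) b)" for b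
    using z(2) by (intro continuous_on_compose2[OF smooth_on_continuous[OF smooth_on_frechet[OF f(1)]]
          C1_on_continuous[OF z(1)]]) auto
  then have "continuous_on J (\<lambda>s. \<Sum>b\<in>Basis. (z' s \<bullet> b) *\<^sub>R ?D (z s) b)"
    by (intro continuous_on_sum continuous_on_scaleR continuous_on_inner z'(2) continuous_on_const)
  then have "continuous_on J (\<lambda>s. ?D (z s) (z' s))"
    by (rule continuous_on_eq) (simp add: linear_expand_Basis[OF smooth_on_frechet_linear[OF f z(2)], of _ "z' _"])
  then show ?thesis unfolding C1_on_def
    by (intro exI[of _ "\<lambda>s. ?D (z s) (z' s)"] conjI ballI
        has_vector_derivative_smooth_compose[OF f z(2) z'(1)])
qed

lemma C1_on_smooth_derivative_compose:
  assumes f: "smooth_on f U" "open U" and z: "C1_on z J" "\<And>s. s \<in> J \<Longrightarrow> z s \<in> U" and w: "C1_on w J"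
  shows "C1_on (\<lambda>s. frechet_derivative f (at (z s)) (w s)) J"
proof -
  have "C1_on (\<lambda>s. \<Sum>b\<in>Basis. (w s \<bullet> b) *\<^sub>R frechet_derivative f (at (z s)) b) J"
    by (intro C1_on_sum C1_on_scaleR C1_on_inner_left w
        C1_on_smooth_compose[OF smooth_on_frechet[OF f(1)] f(2) z])
  then show ?thesis
    by (rule C1_on_eq) (simp add: linear_expand_Basis[OF smooth_on_frechet_linear[OF f z(2)], of _ "w _"])
qed

text \<open>By the chain rule the first derivative is the differential of \<open>f\<close> at
  \<open>z\<close> applied to \<open>z'\<close>, again C^1. Applied to transition maps, it shows
  that a curve which is C^2 in one chart of the hypersurface is C^2 in all of them.\<close>

lemma C2_on_smooth_compose:
  assumes f: "smooth_on f U" "open U" and z: "C2_on z J" "\<And>s. s \<in> J \<Longrightarrow> z s \<in> U"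
  shows "C2_on (\<lambda>s. f (z s)) J"
proof -
  obtain z' where z': "\<And>s. s \<in> J \<Longrightarrow> (z has_vector_derivative z' s) (at s within J)" "C1_on z' J"
    using z unfolding C2_on_iff_C1_on by blast
  have "C1_on z J" by (rule C1_onI[OF z'(1) C1_on_continuous[OF z'(2)]])
  then show ?thesis unfolding C2_on_iff_C1_on
    by (intro exI[of _ "\<lambda>s. frechet_derivative f (at (z s)) (z' s)"] conjI ballI
        has_vector_derivative_smooth_compose[OF f z(2) z'(1)]
        C1_on_smooth_derivative_compose[OF f _ z(2) z'(2)])
qed

lemma C1_on_bilinear_family:
  fixes G :: "'c::euclidean_space \<Rightarrow> 'a::euclidean_space \<Rightarrow> 'a \<Rightarrow> real"
  assumes G: "\<And>u v. smooth_on (\<lambda>x. G x u v) U" "open U" "\<And>x. x \<in> U \<Longrightarrow> bilinear (G x)"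
    and w: "C1_on w J" "\<And>s. s \<in> J \<Longrightarrow> w s \<in> U" and "C1_on a J" "C1_on b J"
  shows "C1_on (\<lambda>s. G (w s) (a s) (b s)) J"
proof -
  have "C1_on (\<lambda>s. \<Sum>i\<in>Basis. (a s \<bullet> i) *\<^sub>R (\<Sum>j\<in>Basis. (b s \<bullet> j) *\<^sub>R G (w s) i j)) J"
    by (intro C1_on_sum C1_on_scaleR C1_on_inner_left C1_on_smooth_compose[OF G(1,2)] assms)
  then show ?thesis
  proof (rule C1_on_eq)
    fix s assume "s \<in> J"
    then have lin: "linear (\<lambda>u. G (w s) u (b s))" "\<And>u. linear (G (w s) u)"
      using G(3) w(2) unfolding bilinear_def by auto
    have "G (w s) (a s) (b s) = (\<Sum>i\<in>Basis. (a s \<bullet> i) *\<^sub>R G (w s) i (b s))"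
      by (rule linear_expand_Basis[OF lin(1)])
    also have "\<dots> = (\<Sum>i\<in>Basis. (a s \<bullet> i) *\<^sub>R (\<Sum>j\<in>Basis. (b s \<bullet> j) *\<^sub>R G (w s) i j))"
      by (simp only: linear_expand_Basis[OF lin(2), of _ "b s"])
    finally show "(\<Sum>i\<in>Basis. (a s \<bullet> i) *\<^sub>R (\<Sum>j\<in>Basis. (b s \<bullet> j) *\<^sub>R G (w s) i j)) = G (w s) (a s) (b s)" ..
  qed
qed

lemma C1_on_real_compose:
  fixes \<phi> :: "real \<Rightarrow> 'a::real_normed_vector"
  assumes "C1_on \<phi> W" "C1_on t J" "\<And>s. s \<in> J \<Longrightarrow> t s \<in> W"
  shows "C1_on (\<lambda>s. \<phi> (t s)) J"
proof -
  obtain \<phi>' t' where *: "\<forall>s\<in>W. (\<phi> has_vector_derivative \<phi>' s) (at s within W)" "continuous_on W \<phi>'"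
    "\<forall>s\<in>J. (t has_vector_derivative t' s) (at s within J)" "continuous_on J t'"
    using assms unfolding C1_on_def by blast
  have "((\<lambda>s. \<phi> (t s)) has_vector_derivative t' s *\<^sub>R \<phi>' (t s)) (at s within J)" if "s \<in> J" for s
    using vector_diff_chain_within[of t "t' s" s J \<phi> "\<phi>' (t s)"] * assms(3) that
      has_vector_derivative_within_subset[of \<phi> "\<phi>' (t s)" "t s" W "t ` J"]
    by (auto simp: o_def)
  moreover have "continuous_on J (\<lambda>s. \<phi>' (t s))"
    using assms(3) by (intro continuous_on_compose2[OF *(2) C1_on_continuous[OF assms(2)]]) auto
  then have "continuous_on J (\<lambda>s. t' s *\<^sub>R \<phi>' (t s))"
    by (intro continuous_on_scaleR *(4))
  ultimately show ?thesis by (rule C1_onI)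
qed

lemma C1_on_inverse_sqrt:
  fixes f :: "real \<Rightarrow> real"
  assumes "C1_on f J" "\<And>s. s \<in> J \<Longrightarrow> 0 < f s"
  shows "C1_on (\<lambda>s. 1 / sqrt (f s)) J"
proof -
  have "((\<lambda>x. 1 / sqrt x) has_real_derivative - (inverse (sqrt x) / 2) / (sqrt x)\<^sup>2) (at x within {0<..})"
    if "0 < x" for x
    using that by (auto intro!: derivative_eq_intros simp: power2_eq_square)
  then have "C1_on (\<lambda>x. 1 / sqrt x) {0<..}"
    unfolding C1_on_def
    by (intro exI[of _ "\<lambda>x. - (inverse (sqrt x) / 2) / (sqrt x)\<^sup>2"])
       (auto simp: has_real_derivative_iff_has_vector_derivative intro!: continuous_intros)
  then show ?thesis using assms by (intro C1_on_real_compose[of "\<lambda>x. 1 / sqrt x" "{0<..}" f]) auto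
qed

section \<open>Hypersurfaces in coordinates\<close>

text \<open>The local geometry in a single pair of charts: \<open>F\<close> is the inclusion read in
  coordinates, \<open>X\<close> the unit normal along it, \<open>G\<close> the ambient metric and
  \<open>C\<close> its Christoffel map. Torsion-freeness is \<open>C_sym\<close> and metric
  compatibility is \<open>G_parallel\<close>.\<close>

locale hypersurface_in_coordinates =
  fixes V :: "'b::euclidean_space set" and F :: "'b \<Rightarrow> 'a::euclidean_space" and X :: "'b \<Rightarrow> 'a"
    and U :: "'a set" and G :: "'a \<Rightarrow> 'a \<Rightarrow> 'a \<Rightarrow> real" and C :: "'a \<Rightarrow> 'a \<Rightarrow> 'a \<Rightarrow> 'a"
    and \<eta> :: real
  assumes V: "open V" and U: "open U" and F_in_U: "\<And>y. y \<in> V \<Longrightarrow> F y \<in> U"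
    and F_smooth: "smooth_on F V" and X_smooth: "smooth_on X V"
    and G_smooth: "\<And>u v. smooth_on (\<lambda>x. G x u v) U"
    and G_bilinear: "\<And>x. x \<in> U \<Longrightarrow> bilinear (G x)"
    and G_sym: "\<And>x u v. x \<in> U \<Longrightarrow> G x u v = G x v u"
    and C_bilinear: "\<And>x. x \<in> U \<Longrightarrow> bilinear (C x)"
    and C_sym: "\<And>x u v. x \<in> U \<Longrightarrow> C x u v = C x v u"
    and G_parallel: "\<And>x u v w. x \<in> U \<Longrightarrow>
      frechet_derivative (\<lambda>x. G x u v) (at x) w = G x (C x w u) v + G x u (C x w v)"
    and codim: "DIM('a) = DIM('b) + 1"
    and inj_F': "\<And>y. y \<in> V \<Longrightarrow> inj (frechet_derivative F (at y))"
    and induced_nondeg: "\<And>y. y \<in> V \<Longrightarrow>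
      nondegenerate (\<lambda>u v. G (F y) (frechet_derivative F (at y) u) (frechet_derivative F (at y) v))"
    and \<eta>: "\<eta> = 1 \<or> \<eta> = -1"
    and X_unit: "\<And>y. y \<in> V \<Longrightarrow> G (F y) (X y) (X y) = \<eta>"
    and X_normal: "\<And>y u. y \<in> V \<Longrightarrow> G (F y) (frechet_derivative F (at y) u) (X y) = 0"
begin

definition D :: "'b \<Rightarrow> 'b \<Rightarrow> 'a" where "D y = frechet_derivative F (at y)"

definition D2 :: "'b \<Rightarrow> 'b \<Rightarrow> 'b \<Rightarrow> 'a" where
  "D2 y u v = frechet_derivative (\<lambda>y. D y v) (at y) u"

definition K :: "'b \<Rightarrow> 'b \<Rightarrow> 'b \<Rightarrow> real" where "K y u v = G (F y) (D y u) (D y v)"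

definition cov_X :: "'b \<Rightarrow> 'b \<Rightarrow> 'a" where
  "cov_X y u = frechet_derivative X (at y) u + C (F y) (D y u) (X y)"

definition shape :: "'b \<Rightarrow> 'b \<Rightarrow> 'b" where "shape y u = (THE w. D y w = - cov_X y u)"

text \<open>The ambient covariant acceleration of \<open>F \<circ> z\<close> at a moment when the
  coordinate curve \<open>z\<close> is at \<open>y\<close> with first derivative \<open>u\<close>
  and second derivative \<open>w\<close>.\<close>

definition coord_acc :: "'b \<Rightarrow> 'b \<Rightarrow> 'b \<Rightarrow> 'a" where
  "coord_acc y u w = D2 y u u + D y w + C (F y) (D y u) (D y u)"

context
  fixes y assumes y: "y \<in> V"
begin

lemma G_simps:
  "G (F y) (a + b) c = G (F y) a c + G (F y) b c" "G (F y) c (a + b) = G (F y) c a + G (F y) c b"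
  "G (F y) (a - b) c = G (F y) a c - G (F y) b c" "G (F y) c (a - b) = G (F y) c a - G (F y) c b"
  "G (F y) (r *\<^sub>R a) c = r * G (F y) a c" "G (F y) c (r *\<^sub>R a) = r * G (F y) c a"
  "G (F y) (- a) c = - G (F y) a c" "G (F y) c (- a) = - G (F y) c a"
  "G (F y) 0 c = 0" "G (F y) c 0 = 0"
  using G_bilinear[OF F_in_U[OF y]]
  by (simp_all add: bilinear_ladd bilinear_radd bilinear_lsub bilinear_rsub bilinear_lmul bilinear_rmul
      bilinear_lneg bilinear_rneg bilinear_lzero bilinear_rzero)

lemma G_commute: "G (F y) a b = G (F y) b a"
  by (rule G_sym[OF F_in_U[OF y]])

lemma D_linear: "linear (D y)"
  unfolding D_def by (rule smooth_on_frechet_linear[OF F_smooth V y])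

lemma D_inj: "inj (D y)"
  unfolding D_def by (rule inj_F'[OF y])

lemma F_has_derivative: "(F has_derivative D y) (at y)"
  unfolding D_def by (rule smooth_on_has_derivative[OF F_smooth V y])

lemma D_has_derivative: "((\<lambda>y. D y v) has_derivative (\<lambda>u. D2 y u v)) (at y)"
  unfolding D_def D2_def by (rule smooth_on_has_derivative[OF smooth_on_frechet[OF F_smooth] V y])

lemma D2_sym: "D2 y u v = D2 y v u"
  unfolding D_def D2_def by (rule smooth_on_second_derivative_symmetric[OF F_smooth V y])

lemma D2_linear: "linear (\<lambda>u. D2 y u v)" "linear (D2 y u)"
proof -
  show *: "linear (\<lambda>u. D2 y u v)" for v using D_has_derivative has_derivative_linear by blast
  have "D2 y u = (\<lambda>v. D2 y v u)" using D2_sym by blast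
  then show "linear (D2 y u)" using * by simp
qed

lemma X_has_derivative: "(X has_derivative frechet_derivative X (at y)) (at y)"
  by (rule smooth_on_has_derivative[OF X_smooth V y])

lemma cov_X_linear: "linear (cov_X y)"
proof -
  have "linear (\<lambda>a. C (F y) a (X y))" using C_bilinear[OF F_in_U[OF y]] by (simp add: bilinear_def)
  then have "linear (\<lambda>u. C (F y) (D y u) (X y))"
    using linear_compose[OF D_linear] by (simp add: o_def)
  then show ?thesis
    unfolding cov_X_def by (intro linear_compose_add smooth_on_frechet_linear[OF X_smooth V y])
qed

lemma K_bilinear: "bilinear (K y)"
proof -
  interpret linear "D y" by (rule D_linear)
  show ?thesis unfolding bilinear_def K_def
    by (auto intro!: linearI simp: add scale G_simps)
qed

lemma K_sym: "K y u v = K y v u"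
  unfolding K_def by (rule G_commute)

lemma K_nondegenerate: "nondegenerate (K y)"
  using induced_nondeg[OF y] by (simp add: K_def[abs_def] D_def)

lemma X_orthogonal: "G (F y) (D y u) (X y) = 0" "G (F y) (X y) (D y u) = 0"
  using X_normal[OF y] G_commute by (simp_all add: D_def)

text \<open>Orthogonality to \<open>X\<close> is a single linear condition, and a nontrivial one
  because \<open>X\<close> has square \<eta>, which is not 0.\<close>

lemma tangent_if_orthogonal:
  assumes "G (F y) z (X y) = 0" shows "\<exists>w. D y w = z"
proof (rule range_eq_hyperplane[OF D_linear D_inj _ codim, where f = "\<lambda>z. G (F y) z (X y)" and x = "X y"])
  show "linear (\<lambda>z. G (F y) z (X y))" using G_bilinear[OF F_in_U[OF y]] by (simp add: bilinear_def)
qed (use assms X_orthogonal X_unit[OF y] \<eta> in auto)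

end

text \<open>Metric compatibility along a map \<open>w\<close>: by \<open>G_parallel\<close> the
  derivative of \<open>G\<close> in its base point supplies exactly the Christoffel terms of the two
  covariant derivatives. The domain of \<open>w\<close> is an arbitrary normed space, so that the
  rule covers both fields over \<open>V\<close> and curves.\<close>

lemma metric_product_rule:
  fixes w :: "'x::real_normed_vector \<Rightarrow> 'a"
  assumes s: "s \<in> J" "\<And>t. t \<in> J \<Longrightarrow> w t \<in> U" and w: "(w has_derivative w') (at s within J)"
    and a: "(a has_derivative a') (at s within J)" and b: "(b has_derivative b') (at s within J)"
  shows "((\<lambda>t. G (w t) (a t) (b t)) has_derivative
    (\<lambda>h. G (w s) (a' h + C (w s) (w' h) (a s)) (b s) + G (w s) (a s) (b' h + C (w s) (w' h) (b s))))
    (at s within J)"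
proof -
  let ?G' = "\<lambda>h u v. G (w s) (C (w s) (w' h) u) v + G (w s) u (C (w s) (w' h) v)"
  have ws: "w s \<in> U" using s by blast
  note gb = G_bilinear[OF ws] note cb = C_bilinear[OF ws]
  note lin = bilinear_ladd[OF gb] bilinear_radd[OF gb] bilinear_lmul[OF gb] bilinear_rmul[OF gb]
    bilinear_radd[OF cb] bilinear_rmul[OF cb]
  have "((\<lambda>t. G (w t) u v) has_derivative (\<lambda>h. ?G' h u v)) (at s within J)" for u v
    using has_derivative_compose[OF w smooth_on_has_derivative[OF G_smooth U ws]]
    by (simp add: G_parallel[OF ws])
  moreover have "bilinear (?G' h)" for h
    unfolding bilinear_def by (auto intro!: linearI simp: lin algebra_simps)
  ultimately have "((\<lambda>t. G (w t) (a t) (b t)) has_derivative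
      (\<lambda>h. ?G' h (a s) (b s) + G (w s) (a' h) (b s) + G (w s) (a s) (b' h))) (at s within J)"
    using s G_bilinear a b
    by (intro has_derivative_bilinear_family[where G = "\<lambda>t. G (w t)" and G' = ?G']) auto
  moreover have "(\<lambda>h. ?G' h (a s) (b s) + G (w s) (a' h) (b s) + G (w s) (a s) (b' h))
      = (\<lambda>h. G (w s) (a' h + C (w s) (w' h) (a s)) (b s) + G (w s) (a s) (b' h + C (w s) (w' h) (b s)))"
    by (simp add: lin algebra_simps)
  ultimately show ?thesis by simp
qed

text \<open>Applied to \<open>X\<close> with itself, it says that the derivative of the unit normal
  is tangent; applied to a tangent coordinate field and \<open>X\<close>, which are orthogonal, it
  is the Weingarten relation.\<close>

lemma constant_product_derivative:
  assumes y: "y \<in> V" and a: "(a has_derivative a') (at y)" and b: "(b has_derivative b') (at y)"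
    and const: "\<And>t. t \<in> V \<Longrightarrow> G (F t) (a t) (b t) = k"
  shows "G (F y) (a' h + C (F y) (D y h) (a y)) (b y) + G (F y) (a y) (b' h + C (F y) (D y h) (b y)) = 0"
proof -
  note wi = has_derivative_at_withinI[where s = V]
  have 1: "((\<lambda>t. G (F t) (a t) (b t)) has_derivative
    (\<lambda>h. G (F y) (a' h + C (F y) (D y h) (a y)) (b y) + G (F y) (a y) (b' h + C (F y) (D y h) (b y))))
    (at y within V)"
    by (rule metric_product_rule[OF y F_in_U wi[OF F_has_derivative[OF y]] wi[OF a] wi[OF b]])
  have 2: "((\<lambda>t. G (F t) (a t) (b t)) has_derivative (\<lambda>h. 0)) (at y within V)"
    using const by (intro has_derivative_transform[OF y const has_derivative_const])
  show ?thesis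
    using fun_cong[OF has_derivative_unique[OF 1[unfolded at_within_open[OF y V]]
          2[unfolded at_within_open[OF y V]]], of h] .
qed

lemma cov_X_orthogonal:
  assumes y: "y \<in> V" shows "G (F y) (cov_X y u) (X y) = 0"
  using constant_product_derivative[OF y X_has_derivative[OF y] X_has_derivative[OF y] X_unit, of u]
  by (simp add: cov_X_def G_commute[OF y, of "X y"])

lemma second_fundamental_form:
  assumes y: "y \<in> V"
  shows "G (F y) (D2 y u v + C (F y) (D y u) (D y v)) (X y) = - G (F y) (D y v) (cov_X y u)"
  using constant_product_derivative[OF y D_has_derivative[OF y] X_has_derivative[OF y] X_orthogonal(1), of u v]
  by (simp add: cov_X_def)

text \<open>The description in \<open>shape\<close> is proper: the covariant derivative of
  \<open>X\<close> is orthogonal to \<open>X\<close>, hence tangent, and \<open>D y\<close> is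
  injective.\<close>

lemma D_shape:
  assumes y: "y \<in> V" shows "D y (shape y u) = - cov_X y u"
proof -
  obtain w where "D y w = - cov_X y u"
    using tangent_if_orthogonal[OF y, of "- cov_X y u"] cov_X_orthogonal[OF y] by (auto simp: G_simps[OF y])
  then have "\<exists>!w. D y w = - cov_X y u" using injD[OF D_inj[OF y]] by metis
  then show ?thesis unfolding shape_def by (rule theI')
qed

lemma shape_linear:
  assumes y: "y \<in> V" shows "linear (shape y)"
proof (rule linearI)
  interpret D: linear "D y" by (rule D_linear[OF y])
  interpret c: linear "cov_X y" by (rule cov_X_linear[OF y])
  show "shape y (u + v) = shape y u + shape y v" for u v
    by (rule injD[OF D_inj[OF y]]) (simp add: D_shape[OF y] D.add c.add)
  show "shape y (r *\<^sub>R u) = r *\<^sub>R shape y u" for r u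
    by (rule injD[OF D_inj[OF y]]) (simp add: D_shape[OF y] D.scale c.scale)
qed

lemma second_fundamental_form_shape:
  assumes y: "y \<in> V"
  shows "G (F y) (D2 y u v + C (F y) (D y u) (D y v)) (X y) = K y (shape y u) v"
  unfolding second_fundamental_form[OF y] K_def D_shape[OF y]
  by (simp add: G_simps[OF y] G_commute[OF y])

text \<open>Both sides are values of the second fundamental form, which is symmetric because second
  derivatives commute and the connection is torsion-free.\<close>

lemma shape_self_adjoint:
  assumes y: "y \<in> V" shows "K y (shape y u) v = K y (shape y v) u"
  unfolding second_fundamental_form_shape[OF y, symmetric]
  using D2_sym[OF y] C_sym[OF F_in_U[OF y]] by metis

text \<open>The term \<open>D y w\<close> is tangent, so the normal part of the acceleration depends
  on the velocity alone.\<close>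

lemma normal_component_acc:
  assumes y: "y \<in> V" shows "G (F y) (coord_acc y u w) (X y) = K y (shape y u) u"
  unfolding second_fundamental_form_shape[OF y, symmetric] coord_acc_def
  by (simp add: G_simps[OF y] X_orthogonal[OF y])

text \<open>Pythagoras for the splitting into \<open>z\<close> and a multiple of \<open>X\<close>;
  since \<open>X\<close> has square \<eta>, the square of the normal part carries the factor
  \<eta>.\<close>

lemma acc_square:
  assumes y: "y \<in> V" and z: "z = coord_acc y u w - (\<eta> * G (F y) (coord_acc y u w) (X y)) *\<^sub>R X y"
  shows "G (F y) (coord_acc y u w) (coord_acc y u w) = G (F y) z z + \<eta> * (K y (shape y u) u)\<^sup>2"
proof -
  have "G (F y) z (X y) = 0"
    unfolding z using \<eta> by (auto simp: G_simps[OF y] X_unit[OF y])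
  moreover from this have "G (F y) (X y) z = 0" by (simp only: G_commute[OF y])
  moreover have "coord_acc y u w = z + (\<eta> * K y (shape y u) u) *\<^sub>R X y"
    by (simp add: z normal_component_acc[OF y])
  ultimately show ?thesis
    using \<eta> by (auto simp: G_simps[OF y] X_unit[OF y] power2_eq_square)
qed

lemma velocity_has_derivative:
  assumes z: "(z has_vector_derivative z') (at s within J)" "z s \<in> V"
  shows "((\<lambda>t. F (z t)) has_vector_derivative D (z s) z') (at s within J)"
  unfolding D_def by (rule has_vector_derivative_smooth_compose[OF F_smooth V z(2,1)])

lemma acceleration_has_derivative:
  assumes s: "s \<in> J" and z: "\<And>t. t \<in> J \<Longrightarrow> z t \<in> V"
    and z': "(z has_vector_derivative z' s) (at s within J)"
    and z'': "(z' has_vector_derivative z'') (at s within J)"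
  shows "((\<lambda>t. D (z t) (z' t)) has_vector_derivative D2 (z s) (z' s) (z' s) + D (z s) z'') (at s within J)"
proof -
  have zs: "z s \<in> V" using s z by blast
  have "((\<lambda>t. D (z t) v) has_derivative (\<lambda>h. h *\<^sub>R D2 (z s) (z' s) v)) (at s within J)" for v
    using has_derivative_compose[OF z'[unfolded has_vector_derivative_def] D_has_derivative[OF zs]]
      linear_scale[OF D2_linear(1)[OF zs]] by simp
  moreover have "linear (\<lambda>v. h *\<^sub>R D2 (z s) (z' s) v)" for h
    by (intro linear_compose_scale_right D2_linear(2) zs)
  ultimately have "((\<lambda>t. D (z t) (z' t)) has_derivative
      (\<lambda>h. h *\<^sub>R D2 (z s) (z' s) (z' s) + D (z s) (h *\<^sub>R z''))) (at s within J)"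
    using z'' D_linear[OF z] s unfolding has_vector_derivative_def
    by (intro has_derivative_linear_family[where M = "\<lambda>t. D (z t)" and M' = "\<lambda>h v. h *\<^sub>R D2 (z s) (z' s) v"]) auto
  then show ?thesis
    by (simp add: has_vector_derivative_def linear_scale[OF D_linear[OF zs]] scaleR_add_right)
qed

text \<open>A quadratic curve in coordinates with the right initial acceleration, reparametrized by arc
  length. Constant speed makes the acceleration orthogonal to the velocity, hence the
  reparametrization adds no tangential term.\<close>

lemma unit_speed_curve_with_normal_acc:
  assumes y: "y \<in> V" and \<epsilon>: "K y u u = \<epsilon>" "\<epsilon> = 1 \<or> \<epsilon> = -1"
  shows "\<exists>\<delta>>0. \<exists>z z' z''. z 0 = y \<and> z' 0 = u \<and> continuous_on {-\<delta><..<\<delta>} z'' \<and>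
    (\<forall>s\<in>{-\<delta><..<\<delta>}. z s \<in> V \<and> K (z s) (z' s) (z' s) = \<epsilon> \<and>
      (z has_vector_derivative z' s) (at s) \<and> (z' has_vector_derivative z'' s) (at s)) \<and>
    (\<exists>k. coord_acc y u (z'' 0) = k *\<^sub>R X y)"
proof -
  interpret D: linear "D y" by (rule D_linear[OF y])
  define a where "a = D2 y u u + C (F y) (D y u) (D y u)"
  have "G (F y) (a - (\<eta> * G (F y) a (X y)) *\<^sub>R X y) (X y) = 0"
    using \<eta> by (auto simp: G_simps[OF y] X_unit[OF y])
  then obtain w0 where w0: "D y w0 = a - (\<eta> * G (F y) a (X y)) *\<^sub>R X y"
    using tangent_if_orthogonal[OF y] by blast
  \<comment> \<open>\<open>a\<close> is the acceleration of the straight coordinate line through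
    \<open>y\<close> in direction \<open>u\<close>; bending it with second derivative
    \<open>w\<close> cancels the tangential part of \<open>a\<close>.\<close>
  define w where "w = - w0"
  define \<beta> where "\<beta> t = y + t *\<^sub>R u + (t\<^sup>2 / 2) *\<^sub>R w" for t :: real
  define \<beta>' where "\<beta>' t = u + t *\<^sub>R w" for t :: real
  have \<beta>_der: "(\<beta> has_vector_derivative \<beta>' t) (at t within J)" for t J
    unfolding \<beta>_def \<beta>'_def by (auto intro!: derivative_eq_intros simp: has_vector_derivative_def algebra_simps)
  have \<beta>'_C1: "C1_on \<beta>' J" for J
    unfolding \<beta>'_def by (intro C1_on_add C1_on_scaleR C1_on_const C1_on_id)
  have \<beta>_C1: "C1_on \<beta> J" for J
    using C1_onI[OF \<beta>_der C1_on_continuous[OF \<beta>'_C1]] .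
  \<comment> \<open>The factor \<epsilon> makes this the absolute squared speed as long as the
    causal character of \<open>u\<close> persists; in particular \<open>f 0 = 1\<close>.\<close>
  define f where "f t = K (\<beta> t) (\<beta>' t) (\<beta>' t) * \<epsilon>" for t
  define W where "W = \<beta> -` V"
  have W: "open W"
    unfolding W_def using continuous_open_preimage[OF C1_on_continuous[OF \<beta>_C1], of UNIV V] V by simp
  have \<beta>_V: "\<And>t. t \<in> W \<Longrightarrow> \<beta> t \<in> V" by (simp add: W_def)
  have f_C1: "C1_on f W"
  proof -
    have "C1_on (\<lambda>t. F (\<beta> t)) W" "C1_on (\<lambda>t. D (\<beta> t) (\<beta>' t)) W"
      unfolding D_def
      using C1_on_smooth_compose[OF F_smooth V \<beta>_C1 \<beta>_V]
        C1_on_smooth_derivative_compose[OF F_smooth V \<beta>_C1 \<beta>_V \<beta>'_C1] by blast+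
    then have "C1_on (\<lambda>t. K (\<beta> t) (\<beta>' t) (\<beta>' t)) W"
      unfolding K_def using F_in_U \<beta>_V
      by (intro C1_on_bilinear_family[of G U] G_smooth U G_bilinear) auto
    then have "C1_on (\<lambda>t. K (\<beta> t) (\<beta>' t) (\<beta>' t) *\<^sub>R \<epsilon>) W" by (intro C1_on_scaleR C1_on_const)
    then show ?thesis by (simp add: f_def[abs_def])
  qed
  define W' where "W' = {t \<in> W. f t \<in> {0<..}}"
  have W': "open W'"
    unfolding W'_def using continuous_open_preimage[OF C1_on_continuous[OF f_C1] W, of "{0<..}"]
    by (simp add: vimage_def Int_def)
  have f0: "f 0 = 1" "0 \<in> W"
    using \<epsilon> y by (auto simp: f_def \<beta>_def \<beta>'_def W_def)
  then have "0 \<in> W'" by (simp add: W'_def)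
  then obtain r where r: "r > 0" "{-r..r} \<subseteq> W'"
    using W' unfolding open_contains_cball by (auto simp: cball_eq_atLeastAtMost)
  \<comment> \<open>The reciprocal of the speed: a parameter change \<tau> with
    \<open>\<tau>' = \<phi> (\<tau>)\<close> makes the curve unit speed.\<close>
  define \<phi> where "\<phi> t = 1 / sqrt (f t)" for t
  have \<phi>_C1: "C1_on \<phi> W'"
    unfolding \<phi>_def by (intro C1_on_inverse_sqrt C1_on_subset[OF f_C1]) (auto simp: W'_def)
  have "continuous_on {-r..r} \<phi>" "\<And>t. t \<in> {-r..r} \<Longrightarrow> 0 < \<phi> t"
    using r continuous_on_subset[OF C1_on_continuous[OF \<phi>_C1]] by (auto simp: \<phi>_def W'_def)
  then obtain \<delta> \<tau> where \<delta>: "\<delta> > 0" and \<tau>0: "\<tau> 0 = 0"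
    and \<tau>: "\<And>s. s \<in> {-\<delta><..<\<delta>} \<Longrightarrow> \<tau> s \<in> {-r<..<r}"
      "\<And>s. s \<in> {-\<delta><..<\<delta>} \<Longrightarrow> (\<tau> has_real_derivative \<phi> (\<tau> s)) (at s)"
    using autonomous_ode_local_solution[OF r(1)] by blast
  let ?J = "{-\<delta><..<\<delta>}"
  have \<tau>_W': "\<And>s. s \<in> ?J \<Longrightarrow> \<tau> s \<in> W'" using \<tau>(1) r(2) by force
  have \<tau>_der: "(\<tau> has_vector_derivative \<phi> (\<tau> s)) (at s)" if "s \<in> ?J" for s
    using \<tau>(2)[OF that] by (simp add: has_real_derivative_iff_has_vector_derivative)
  have "continuous_on ?J \<tau>"
    using \<tau>(2) DERIV_isCont by (intro continuous_at_imp_continuous_on) blast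
  then have "continuous_on ?J (\<lambda>s. \<phi> (\<tau> s))"
    using \<tau>_W' by (intro continuous_on_compose2[OF C1_on_continuous[OF \<phi>_C1]]) auto
  then have \<tau>_C1: "C1_on \<tau> ?J"
    using \<tau>_der has_vector_derivative_at_within by (intro C1_onI[of ?J \<tau> "\<lambda>s. \<phi> (\<tau> s)"]) blast+
  define \<psi> where "\<psi> s = \<phi> (\<tau> s)" for s
  have \<psi>_C1: "C1_on \<psi> ?J"
    unfolding \<psi>_def by (rule C1_on_real_compose[OF \<phi>_C1 \<tau>_C1 \<tau>_W'])
  then obtain \<psi>' where \<psi>': "\<forall>s\<in>?J. (\<psi> has_vector_derivative \<psi>' s) (at s within ?J)" "continuous_on ?J \<psi>'"
    unfolding C1_on_def by blast
  have \<psi>_der: "(\<psi> has_vector_derivative \<psi>' s) (at s)" if "s \<in> ?J" for s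
    using bspec[OF \<psi>'(1) that] by (simp only: at_within_open[OF that open_greaterThanLessThan])
  define z where "z s = \<beta> (\<tau> s)" for s
  define z' where "z' s = \<psi> s *\<^sub>R u + (\<psi> s * \<tau> s) *\<^sub>R w" for s
  define z'' where "z'' s = \<psi>' s *\<^sub>R u + (\<psi> s * \<psi> s + \<psi>' s * \<tau> s) *\<^sub>R w" for s
  have z'_eq: "z' s = \<psi> s *\<^sub>R \<beta>' (\<tau> s)" for s
    by (simp add: z'_def \<beta>'_def scaleR_add_right)
  have z_der: "(z has_vector_derivative z' s) (at s)" if "s \<in> ?J" for s
    using vector_diff_chain_within[OF \<tau>_der[OF that] \<beta>_der] by (simp add: z_def[abs_def] z'_eq \<psi>_def o_def)
  have z'_der: "(z' has_vector_derivative z'' s) (at s)" if "s \<in> ?J" for s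
  proof -
    have "((\<lambda>s. \<psi> s * \<tau> s) has_vector_derivative \<psi> s * \<psi> s + \<psi>' s * \<tau> s) (at s)"
      using has_vector_derivative_mult[OF \<psi>_der[OF that] \<tau>_der[OF that]] by (simp add: \<psi>_def)
    then show ?thesis unfolding z'_def z''_def
      using \<psi>_der[OF that] has_vector_derivative_const
        has_vector_derivative_scaleR[of _ _ s UNIV "\<lambda>s. u" 0] has_vector_derivative_scaleR[of _ _ s UNIV "\<lambda>s. w" 0]
      by (auto intro!: has_vector_derivative_add simp: has_real_derivative_iff_has_vector_derivative)
  qed
  have z''_cont: "continuous_on ?J z''"
    unfolding z''_def
    by (intro continuous_on_add continuous_on_scaleR continuous_on_mult continuous_on_const \<psi>'(2)
        C1_on_continuous[OF \<psi>_C1] C1_on_continuous[OF \<tau>_C1])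
  have z_V: "z s \<in> V" if "s \<in> ?J" for s
    using \<tau>_W'[OF that] by (simp add: z_def W'_def W_def)
  have speed: "K (z s) (z' s) (z' s) = \<epsilon>" if "s \<in> ?J" for s
  proof -
    have f: "f (\<tau> s) > 0" using \<tau>_W'[OF that] by (simp add: W'_def)
    note bil = K_bilinear[OF z_V[OF that]]
    have "K (z s) (z' s) (z' s) = (\<psi> s)\<^sup>2 * K (z s) (\<beta>' (\<tau> s)) (\<beta>' (\<tau> s))"
      by (simp add: z'_eq bilinear_lmul[OF bil] bilinear_rmul[OF bil] power2_eq_square)
    also have "K (z s) (\<beta>' (\<tau> s)) (\<beta>' (\<tau> s)) = \<epsilon> * f (\<tau> s)" using \<epsilon> by (auto simp: f_def z_def)
    finally show ?thesis using f by (simp add: \<psi>_def \<phi>_def power_divide)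
  qed
  have zero: "0 \<in> ?J" using \<delta> by simp
  have init: "z 0 = y" "z' 0 = u" "z'' 0 = \<psi>' 0 *\<^sub>R u + w"
    using \<tau>0 f0 by (auto simp: z_def z'_def z''_def \<beta>_def \<psi>_def \<phi>_def)
  define c where "c = coord_acc y u (z'' 0)"
  \<comment> \<open>Since \<open>\<tau> 0 = 0\<close> and \<open>\<psi> 0 = 1\<close>, the new
    parameter can disturb the acceleration at 0 only by a multiple of the velocity.\<close>
  have c: "c = (\<eta> * G (F y) a (X y)) *\<^sub>R X y + \<psi>' 0 *\<^sub>R D y u"
    by (simp add: c_def coord_acc_def init w_def D.add D.diff D.scale D.neg w0) (simp add: a_def)
  \<comment> \<open>Half the derivative at 0 of the constant squared speed. As \<open>X y\<close> is
    orthogonal to \<open>D y u\<close>, only \<open>\<psi>' 0 * \<epsilon>\<close> remains of this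
    product, so the disturbance vanishes.\<close>
  have "G (F y) c (D y u) = 0"
  proof -
    have w1: "((\<lambda>t. F (z t)) has_derivative (\<lambda>h. h *\<^sub>R D y u)) (at 0 within ?J)"
      using velocity_has_derivative[OF has_vector_derivative_at_within[OF z_der[OF zero]] z_V[OF zero]]
      by (simp add: has_vector_derivative_def init)
    have v1: "((\<lambda>t. D (z t) (z' t)) has_derivative (\<lambda>h. h *\<^sub>R (D2 y u u + D y (z'' 0)))) (at 0 within ?J)"
      using acceleration_has_derivative[OF zero z_V has_vector_derivative_at_within[OF z_der[OF zero]]
          has_vector_derivative_at_within[OF z'_der[OF zero]]]
      by (simp add: has_vector_derivative_def init)
    have "((\<lambda>t. G (F (z t)) (D (z t) (z' t)) (D (z t) (z' t))) has_derivative
      (\<lambda>h. G (F y) (h *\<^sub>R (D2 y u u + D y (z'' 0)) + C (F y) (h *\<^sub>R D y u) (D y u)) (D y u)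
         + G (F y) (D y u) (h *\<^sub>R (D2 y u u + D y (z'' 0)) + C (F y) (h *\<^sub>R D y u) (D y u)))) (at 0 within ?J)"
      using metric_product_rule[OF zero _ w1 v1 v1] F_in_U z_V by (simp add: init)
    moreover have "((\<lambda>t. G (F (z t)) (D (z t) (z' t)) (D (z t) (z' t))) has_derivative (\<lambda>h. 0)) (at 0 within ?J)"
      using speed by (intro has_derivative_transform[OF zero _ has_derivative_const[of \<epsilon>]]) (simp add: K_def)
    ultimately have "(\<lambda>h::real. G (F y) (h *\<^sub>R (D2 y u u + D y (z'' 0)) + C (F y) (h *\<^sub>R D y u) (D y u)) (D y u)
         + G (F y) (D y u) (h *\<^sub>R (D2 y u u + D y (z'' 0)) + C (F y) (h *\<^sub>R D y u) (D y u))) = (\<lambda>h. 0)"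
      unfolding at_within_open[OF zero open_greaterThanLessThan] by (rule has_derivative_unique)
    from fun_cong[OF this, of 1] show ?thesis
      by (simp add: c_def coord_acc_def G_commute[OF y, of "D y u"])
  qed
  then have "\<psi>' 0 * \<epsilon> = 0"
    using \<epsilon> by (simp add: c G_simps[OF y] X_orthogonal[OF y] K_def)
  then have "c = (\<eta> * G (F y) a (X y)) *\<^sub>R X y" using c \<epsilon> by auto
  then have k: "\<exists>k. coord_acc y u (z'' 0) = k *\<^sub>R X y" unfolding c_def by blast
  have all: "\<forall>s\<in>?J. z s \<in> V \<and> K (z s) (z' s) (z' s) = \<epsilon> \<and>
      (z has_vector_derivative z' s) (at s) \<and> (z' has_vector_derivative z'' s) (at s)"
    using z_V speed z_der z'_der by simp
  show ?thesis
    by (rule exI[of _ \<delta>], rule conjI[OF \<delta>], rule exI[of _ z], rule exI[of _ z'], rule exI[of _ z''])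
      (intro conjI init(1,2) z''_cont all k)
qed

end

section \<open>Hypersurfaces of semi-Riemannian manifolds\<close>

lemma chart_on_facts:
  assumes "chart_on T c"
  shows "openin T (cdom c)" "open (coord c ` cdom c)" "inj_on (coord c) (cdom c)"
    and "topspace (subtopology T (cdom c)) = cdom c"
proof -
  show o: "openin T (cdom c)" "open (coord c ` cdom c)" using assms by (auto simp: chart_on_def)
  show t: "topspace (subtopology T (cdom c)) = cdom c"
    using openin_subset[OF o(1)] by (auto simp: topspace_subtopology)
  show "inj_on (coord c) (cdom c)"
    using assms t homeomorphic_imp_injective_map unfolding chart_on_def by metis
qed

lemma param_coord: "chart_on T c \<Longrightarrow> p \<in> cdom c \<Longrightarrow> param c (coord c p) = p"
  using chart_on_facts(3) by (rule inv_into_f_f)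

lemma chart_image_open:
  assumes c: "chart_on T c" and W: "openin T W" "W \<subseteq> cdom c"
  shows "open (coord c ` W)"
proof -
  have "openin (subtopology T (cdom c)) W"
    using W chart_on_facts(1)[OF c] by (simp add: openin_open_subtopology)
  then have "openin (top_of_set (coord c ` cdom c)) (coord c ` W)"
    using c homeomorphic_imp_open_map unfolding chart_on_def open_map_def by blast
  then show ?thesis using chart_on_facts(2)[OF c] openin_open_eq by blast
qed

lemma param_continuous:
  assumes c: "chart_on T c"
  shows "continuous_map (top_of_set (coord c ` cdom c)) (subtopology T (cdom c)) (param c)"
proof -
  obtain h where h: "homeomorphic_maps (subtopology T (cdom c)) (top_of_set (coord c ` cdom c)) (coord c) h"
    using c unfolding chart_on_def homeomorphic_map_maps by blast
  then have "h x = param c x" if "x \<in> coord c ` cdom c" for x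
    using that param_coord[OF c] chart_on_facts(4)[OF c] unfolding homeomorphic_maps_def by auto
  then show ?thesis
    using h unfolding homeomorphic_maps_def by (auto intro: continuous_map_eq)
qed

locale semi_riemannian_hypersurface =
  fixes T :: "'p topology"
    and A :: "('p, 'a::euclidean_space) chart set"
    and g :: "('p, 'a) metric"
    and \<nu> :: nat
    and \<Gamma> :: "('p, 'a) connection"
    and S :: "'p set"
    and B :: "('p, 'b::euclidean_space) chart set"
    and \<xi> :: "('p, 'a) vector_field"
    and \<eta> :: real
  assumes manifold: "semi_riemannian_manifold T A g \<nu> \<Gamma>"
    and hypersurface: "hypersurface T A S B"
    and non_lightlike: "non_lightlike_hypersurface A B g"
    and normal: "unit_normal_field A B g \<xi> \<eta>"
begin

lemma chart_A: "c \<in> A \<Longrightarrow> chart_on T c"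
  using manifold unfolding semi_riemannian_manifold_def smooth_manifold_def by blast

lemma chart_B: "d \<in> B \<Longrightarrow> chart_on (subtopology T S) d"
  using hypersurface unfolding hypersurface_def smooth_manifold_def by blast

lemma overlap_openin:
  assumes "c \<in> A" "d \<in> B" shows "openin (subtopology T S) (cdom c \<inter> cdom d)"
proof -
  have d: "openin (subtopology T S) (cdom d)" by (rule chart_on_facts(1)[OF chart_B[OF assms(2)]])
  have "openin (subtopology T S) (cdom c \<inter> S)"
    using chart_on_facts(1)[OF chart_A[OF assms(1)]] by (rule openin_subtopology_Int)
  then have "openin (subtopology T S) ((cdom c \<inter> S) \<inter> cdom d)" using d by (rule openin_Int)
  moreover have "(cdom c \<inter> S) \<inter> cdom d = cdom c \<inter> cdom d"
    using openin_subset[OF d] by (auto simp: topspace_subtopology)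
  ultimately show ?thesis by simp
qed

lemma overlap_open:
  assumes "c \<in> A" "d \<in> B" shows "open (coord d ` (cdom c \<inter> cdom d))"
  by (rule chart_image_open[OF chart_B[OF assms(2)] overlap_openin[OF assms]]) blast

lemma in_coordinates:
  assumes c: "c \<in> A" and d: "d \<in> B"
  shows "hypersurface_in_coordinates (coord d ` (cdom c \<inter> cdom d)) (coord c \<circ> param d)
    (\<lambda>y. \<xi> c (param d y)) (coord c ` cdom c) (\<lambda>x. g c (param c x)) (\<lambda>x. \<Gamma> c (param c x)) \<eta>"
proof -
  note pc = param_coord[OF chart_A[OF c]] and pd = param_coord[OF chart_B[OF d]]
  have M: "semi_riemannian_metric A g \<nu>" "levi_civita A g \<Gamma>"
    using manifold by (auto simp: semi_riemannian_manifold_def)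
  have 1: "open (coord d ` (cdom c \<inter> cdom d))" by (rule overlap_open[OF c d])
  have 2: "open (coord c ` cdom c)" by (rule chart_on_facts(2)[OF chart_A[OF c]])
  have "bilinear (g c p)" "g c p u v = g c p v u" if "p \<in> cdom c" for p u v
    using M(1) c that unfolding semi_riemannian_metric_def by blast+
  moreover have "smooth_on (\<lambda>x. g c (param c x) u v) (coord c ` cdom c)" for u v
    using M(1) c unfolding semi_riemannian_metric_def by blast
  moreover have "bilinear (\<Gamma> c p)" "\<Gamma> c p u v = \<Gamma> c p v u"
    "frechet_derivative (\<lambda>x. g c (param c x) u v) (at (coord c p)) w =
           g c p (\<Gamma> c p w u) v + g c p u (\<Gamma> c p w v)" if "p \<in> cdom c" for p u v w
    using M(2) c that unfolding levi_civita_def by blast+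
  moreover have "DIM('a) = DIM('b) + 1" "smooth_on (coord c \<circ> param d) (coord d ` (cdom c \<inter> cdom d))"
    using hypersurface c d unfolding hypersurface_def by blast+
  moreover have "inj (frechet_derivative (coord c \<circ> param d) (at (coord d p)))"
    if "p \<in> cdom c \<inter> cdom d" for p
    using hypersurface c d that unfolding hypersurface_def coord_deriv_def by blast
  moreover have "nondegenerate (\<lambda>u v. g c p (frechet_derivative (coord c \<circ> param d) (at (coord d p)) u)
      (frechet_derivative (coord c \<circ> param d) (at (coord d p)) v))" if "p \<in> cdom c \<inter> cdom d" for p
    using non_lightlike c d that
    unfolding non_lightlike_hypersurface_def induced_metric_def[abs_def] coord_deriv_def by blast
  moreover have "smooth_on (\<lambda>y. \<xi> c (param d y)) (coord d ` (cdom c \<inter> cdom d))" "\<eta> = 1 \<or> \<eta> = -1"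
    using normal c d unfolding unit_normal_field_def by blast+
  moreover have "g c p (\<xi> c p) (\<xi> c p) = \<eta>"
      "g c p (frechet_derivative (coord c \<circ> param d) (at (coord d p)) u) (\<xi> c p) = 0"
    if "p \<in> cdom c \<inter> cdom d" for p u
    using normal c d that unfolding unit_normal_field_def coord_deriv_def by blast+
  ultimately show ?thesis
    using 1 2 by unfold_locales (auto simp: pc pd simp del: o_apply simp: comp_apply[of "coord c" "param d"])
qed

lemma transition_smooth:
  "c \<in> A \<Longrightarrow> c' \<in> A \<Longrightarrow> smooth_on (coord c' \<circ> param c) (coord c ` (cdom c \<inter> cdom c'))"
  "d \<in> B \<Longrightarrow> d' \<in> B \<Longrightarrow> smooth_on (coord d' \<circ> param d) (coord d ` (cdom d \<inter> cdom d'))"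
proof -
  have "smooth_manifold T A" "smooth_manifold (subtopology T S) B"
    using manifold hypersurface by (auto simp: semi_riemannian_manifold_def hypersurface_def)
  then show "c \<in> A \<Longrightarrow> c' \<in> A \<Longrightarrow> smooth_on (coord c' \<circ> param c) (coord c ` (cdom c \<inter> cdom c'))"
    "d \<in> B \<Longrightarrow> d' \<in> B \<Longrightarrow> smooth_on (coord d' \<circ> param d) (coord d ` (cdom d \<inter> cdom d'))"
    by (simp_all add: smooth_manifold_def)
qed

text \<open>The factorization through \<open>c\<close> holds only where all three charts are
  defined, an open set in the coordinates of \<open>d\<close>. It makes the induced metric
  independent of the ambient chart, as is needed to verify unit speed in every chart.\<close>

lemma coord_deriv_chain:
  assumes c: "c \<in> A" "c' \<in> A" and d: "d \<in> B" and p: "p \<in> cdom c" "p \<in> cdom c'" "p \<in> cdom d"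
  shows "coord_deriv d c' p u = coord_deriv c c' p (coord_deriv d c p u)"
proof -
  interpret h: hypersurface_in_coordinates "coord d ` (cdom c \<inter> cdom d)" "coord c \<circ> param d"
    "\<lambda>y. \<xi> c (param d y)" "coord c ` cdom c" "\<lambda>x. g c (param c x)" "\<lambda>x. \<Gamma> c (param c x)" \<eta>
    by (rule in_coordinates[OF c(1) d])
  note pc = param_coord[OF chart_A[OF c(1)]] and pd = param_coord[OF chart_B[OF d]]
  have "open (coord c ` (cdom c \<inter> cdom c'))"
    using chart_on_facts(1)[OF chart_A] c
    by (intro chart_image_open[OF chart_A[OF c(1)]] openin_Int) auto
  then have 1: "((coord c' \<circ> param c) has_derivative coord_deriv c c' p) (at ((coord c \<circ> param d) (coord d p)))"
    using smooth_on_has_derivative[OF transition_smooth(1)[OF c]] p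
    by (simp add: coord_deriv_def pd)
  have 2: "((coord c \<circ> param d) has_derivative coord_deriv d c p) (at (coord d p))"
    using h.F_has_derivative[of "coord d p"] p by (simp add: h.D_def coord_deriv_def)
  have 3: "open (coord d ` ((cdom c \<inter> cdom d) \<inter> (cdom c' \<inter> cdom d)))"
    by (intro chart_image_open[OF chart_B[OF d]] openin_Int overlap_openin c d) blast
  have "((coord c' \<circ> param d) has_derivative (\<lambda>u. coord_deriv c c' p (coord_deriv d c p u))) (at (coord d p))"
    by (rule has_derivative_transform_within_open[OF has_derivative_compose[OF 2 1] 3])
       (use p in \<open>auto simp: pc pd\<close>)
  then show ?thesis
    using frechet_derivative_at[of "coord c' \<circ> param d"] unfolding coord_deriv_def[of d c'] by metis
qed

lemma induced_metric_chart_independent: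
  assumes c: "c \<in> A" "c' \<in> A" and d: "d \<in> B" and p: "p \<in> cdom c" "p \<in> cdom c'" "p \<in> cdom d"
  shows "induced_metric g d c' p u v = induced_metric g d c p u v"
proof -
  have "g c p u v = g c' p (coord_deriv c c' p u) (coord_deriv c c' p v)" for u v
    using manifold c p unfolding semi_riemannian_manifold_def semi_riemannian_metric_def by blast
  then show ?thesis by (simp add: induced_metric_def coord_deriv_chain[OF assms])
qed

section \<open>Shape operator and curves in one pair of charts\<close>

context
  fixes c :: "('p, 'a) chart" and d :: "('p, 'b) chart"
  assumes c: "c \<in> A" and d: "d \<in> B"
begin

interpretation h: hypersurface_in_coordinates "coord d ` (cdom c \<inter> cdom d)" "coord c \<circ> param d"
  "\<lambda>y. \<xi> c (param d y)" "coord c ` cdom c" "\<lambda>x. g c (param c x)" "\<lambda>x. \<Gamma> c (param c x)" \<eta>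
  by (rule in_coordinates[OF c d])

context
  fixes p assumes p: "p \<in> cdom c" "p \<in> cdom d"
begin

lemma overlap_simps [simp]:
  "param d (coord d p) = p" "param c (coord c p) = p" "coord d p \<in> coord d ` (cdom c \<inter> cdom d)"
  using p param_coord[OF chart_A[OF c]] param_coord[OF chart_B[OF d]] by auto

lemma coord_deriv_eq: "coord_deriv d c p = h.D (coord d p)"
  by (simp add: coord_deriv_def h.D_def)

lemma induced_metric_eq: "induced_metric g d c p = h.K (coord d p)"
  by (simp add: induced_metric_def h.K_def fun_eq_iff coord_deriv_eq)

lemma shape_operator_eq: "shape_operator \<Gamma> \<xi> d c p = h.shape (coord d p)"
  by (simp add: shape_operator_def h.shape_def fun_eq_iff cov_deriv_def h.cov_X_def coord_deriv_eq)

text \<open>The trace of \<kappa> times the identity is \<kappa> times the dimension, so the mean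
  curvature is \<open>\<eta> * \<kappa>\<close>; its sign disappears in the square.\<close>

lemma umbilical_mean_curvature:
  assumes "\<And>u. h.shape (coord d p) u = \<kappa> *\<^sub>R u"
  shows "(mean_curvature \<Gamma> \<xi> \<eta> d c p)\<^sup>2 = \<kappa>\<^sup>2"
proof -
  have "mean_curvature \<Gamma> \<xi> \<eta> d c p = \<eta> * \<kappa>"
    unfolding mean_curvature_def shape_operator_eq assms by (simp add: inner_Basis)
  then show ?thesis using h.\<eta> by auto
qed

end

text \<open>The curve factors through the inclusion \<open>coord c \<circ> param d\<close> only on
  \<open>J\<close>. As \<open>J\<close> is relatively open in \<open>I\<close>, derivatives within
  \<open>J\<close> and within \<open>I\<close> agree, also at an endpoint of \<open>I\<close>;
  \<open>nt\<close> makes them unique, so that \<open>vector_derivative\<close> picks the intended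
  value.\<close>

lemma curve_in_coordinates:
  assumes J: "openin (top_of_set I) J" and dom: "\<And>t. t \<in> J \<Longrightarrow> \<alpha> t \<in> cdom c \<inter> cdom d"
    and nt: "\<And>t. t \<in> J \<Longrightarrow> at t within I \<noteq> bot"
    and z': "\<And>t. t \<in> J \<Longrightarrow> (coord d \<circ> \<alpha> has_vector_derivative z' t) (at t within I)"
    and z'': "\<And>t. t \<in> J \<Longrightarrow> (z' has_vector_derivative z'' t) (at t within I)"
    and s: "s \<in> J"
  shows "velocity I \<alpha> c s = coord_deriv d c (\<alpha> s) (z' s)"
    and "acceleration \<Gamma> I \<alpha> c s = h.coord_acc (coord d (\<alpha> s)) (z' s) (z'' s)"
proof -
  obtain O' where O': "open O'" "J = I \<inter> O'" using J openin_open by blast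
  have within: "at t within I = at t within J" if "t \<in> J" for t
    using at_within_nhd[of t O' I J] O' that by auto
  define z where "z = coord d \<circ> \<alpha>"
  have zV: "z t \<in> coord d ` (cdom c \<inter> cdom d)" if "t \<in> J" for t
    using dom[OF that] by (simp add: z_def)
  have Fz: "(coord c \<circ> \<alpha>) t = (coord c \<circ> param d) (z t)" if "t \<in> J" for t
    using dom[OF that] overlap_simps(1) by (simp add: z_def)
  have vel: "velocity I \<alpha> c t = h.D (z t) (z' t)" if t: "t \<in> J" for t
  proof -
    have Fz': "((\<lambda>t. (coord c \<circ> param d) (z t)) has_vector_derivative h.D (z t) (z' t)) (at t within J)"
      using h.velocity_has_derivative[where z = z, OF _ zV[OF t]] z'[OF t] within[OF t] by (simp add: z_def)
    have "((coord c \<circ> \<alpha>) has_vector_derivative h.D (z t) (z' t)) (at t within J)"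
      by (rule has_vector_derivative_transform[OF t Fz Fz'])
    then show ?thesis
      unfolding velocity_def using vector_derivative_within[OF nt[OF t]] within[OF t] by simp
  qed
  then show "velocity I \<alpha> c s = coord_deriv d c (\<alpha> s) (z' s)"
    using s dom[OF s] coord_deriv_eq by (simp add: z_def)
  have vel': "((\<lambda>t. h.D (z t) (z' t)) has_vector_derivative
      h.D2 (z s) (z' s) (z' s) + h.D (z s) (z'' s)) (at s within J)"
    using h.acceleration_has_derivative[where z = z and z' = z', OF s zV] z'[OF s] z''[OF s] within[OF s] by (simp add: z_def)
  have "(velocity I \<alpha> c has_vector_derivative
      h.D2 (z s) (z' s) (z' s) + h.D (z s) (z'' s)) (at s within J)"
    by (rule has_vector_derivative_transform[OF s vel vel'])
  then have "vector_derivative (velocity I \<alpha> c) (at s within I)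
      = h.D2 (z s) (z' s) (z' s) + h.D (z s) (z'' s)"
    using vector_derivative_within[OF nt[OF s]] within[OF s] by simp
  then show "acceleration \<Gamma> I \<alpha> c s = h.coord_acc (coord d (\<alpha> s)) (z' s) (z'' s)"
    unfolding acceleration_def vel[OF s] h.coord_acc_def
    using dom[OF s] overlap_simps by (simp add: z_def)
qed

lemma acceleration_square:
  assumes p: "\<alpha> s \<in> cdom c" "\<alpha> s \<in> cdom d"
    and acc: "acceleration \<Gamma> I \<alpha> c s = h.coord_acc (coord d (\<alpha> s)) u w"
  shows "g c (\<alpha> s) (acceleration \<Gamma> I \<alpha> c s) (acceleration \<Gamma> I \<alpha> c s)
    = g c (\<alpha> s) (induced_acceleration g \<Gamma> \<xi> \<eta> I \<alpha> c s) (induced_acceleration g \<Gamma> \<xi> \<eta> I \<alpha> c s)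
      + \<eta> * (h.K (coord d (\<alpha> s)) (h.shape (coord d (\<alpha> s)) u) u)\<^sup>2"
  using h.acc_square[OF overlap_simps(3)[OF p], of "induced_acceleration g \<Gamma> \<xi> \<eta> I \<alpha> c s" u w]
  by (simp add: overlap_simps[OF p] acc induced_acceleration_def)

text \<open>Umbilicity makes the normal term \<kappa> times the square of the velocity. The latter
  is 1 or -1, so squaring leaves \<kappa> squared, the squared mean curvature. Both the inequalities
  and the equality case are read off from this identity.\<close>

lemma curve_acceleration_square:
  assumes \<alpha>: "C2_curve (subtopology T S) B I \<alpha>" "unit_speed A g I \<alpha>"
    and s: "s \<in> I" "\<alpha> s \<in> cdom c" "\<alpha> s \<in> cdom d" and umbilical: "totally_umbilical A B g \<Gamma> \<xi>"
  shows "g c (\<alpha> s) (acceleration \<Gamma> I \<alpha> c s) (acceleration \<Gamma> I \<alpha> c s)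
    = g c (\<alpha> s) (induced_acceleration g \<Gamma> \<xi> \<eta> I \<alpha> c s) (induced_acceleration g \<Gamma> \<xi> \<eta> I \<alpha> c s)
      + \<eta> * (mean_curvature \<Gamma> \<xi> \<eta> d c (\<alpha> s))\<^sup>2"
proof -
  note p = s(2,3)
  let ?y = "coord d (\<alpha> s)"
  have y: "?y \<in> coord d ` (cdom c \<inter> cdom d)" by (rule overlap_simps(3)[OF p])
  have cont: "continuous_map (top_of_set I) (subtopology T S) \<alpha>" and I: "is_interval I" "interior I \<noteq> {}"
    and C2: "C2_on (coord d \<circ> \<alpha>) {t \<in> I. \<alpha> t \<in> cdom d}"
    using \<alpha>(1) d unfolding C2_curve_def by auto
  obtain \<epsilon> where \<epsilon>: "\<epsilon> \<in> {1, -1}" "g c (\<alpha> s) (velocity I \<alpha> c s) (velocity I \<alpha> c s) = \<epsilon>"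
    using \<alpha>(2) s c unfolding unit_speed_def by blast
  let ?Jd = "{t \<in> I. \<alpha> t \<in> cdom d}" and ?J = "{t \<in> I. \<alpha> t \<in> cdom c \<inter> cdom d}"
  have preimage: "openin (top_of_set I) {t \<in> I. \<alpha> t \<in> W}" if "openin (subtopology T S) W" for W
    using openin_continuous_map_preimage[OF cont that] by simp
  obtain O' where O': "open O'" "?Jd = I \<inter> O'"
    using preimage[OF chart_on_facts(1)[OF chart_B[OF d]]] openin_open by blast
  have within: "at t within ?Jd = at t within I" if "t \<in> ?Jd" for t
    using at_within_nhd[of t O' ?Jd I] O' that by auto
  obtain z' z'' where z': "\<forall>t\<in>?Jd. (coord d \<circ> \<alpha> has_vector_derivative z' t) (at t within ?Jd)"
    and z'': "\<forall>t\<in>?Jd. (z' has_vector_derivative z'' t) (at t within ?Jd)"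
    using C2 unfolding C2_on_def by (elim exE conjE)
  have z: "(coord d \<circ> \<alpha> has_vector_derivative z' t) (at t within I)"
    "(z' has_vector_derivative z'' t) (at t within I)" if "t \<in> ?Jd" for t
    using bspec[OF z' that] bspec[OF z'' that] unfolding within[OF that] .
  have nt: "at t within I \<noteq> bot" if "t \<in> I" for t
  proof -
    \<comment> \<open>A connected set other than a singleton has no isolated points.\<close>
    have "I \<noteq> {x}" for x using I(2) by auto
    then show ?thesis
      using connected_imp_perfect[of I t] I that
      by (simp add: trivial_limit_within is_interval_connected)
  qed
  note curve = curve_in_coordinates[where \<alpha> = \<alpha> and z' = z' and z'' = z'' and s = s,
      OF preimage[OF overlap_openin[OF c d]]]
  have vel: "velocity I \<alpha> c s = coord_deriv d c (\<alpha> s) (z' s)"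
    by (rule curve(1)) (use s nt z in auto)
  have acc: "acceleration \<Gamma> I \<alpha> c s = h.coord_acc ?y (z' s) (z'' s)"
    by (rule curve(2)) (use s nt z in auto)
  have "\<exists>k. h.shape ?y u = k *\<^sub>R u" if "h.K ?y u u \<noteq> 0" for u
  proof -
    have "u \<noteq> 0" using that by (auto simp: bilinear_lzero[OF h.K_bilinear[OF y]])
    then show ?thesis
      using umbilical c d p that
      unfolding totally_umbilical_def lightlike_def
      by (simp add: shape_operator_eq[OF p, symmetric] induced_metric_eq[OF p, symmetric])
  qed
  then obtain \<kappa> where \<kappa>: "\<And>u. h.shape ?y u = \<kappa> *\<^sub>R u"
    using scalar_if_nonnull_eigenvectors[OF h.K_bilinear[OF y] h.K_sym[OF y] h.K_nondegenerate[OF y]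
        h.shape_linear[OF y]] by blast
  have "h.K ?y (z' s) (z' s) = \<epsilon>" using \<epsilon>(2) by (simp add: vel induced_metric_def flip: induced_metric_eq[OF p])
  then have "(h.K ?y (h.shape ?y (z' s)) (z' s))\<^sup>2 = \<kappa>\<^sup>2"
    using \<epsilon>(1) by (auto simp: \<kappa> bilinear_lmul[OF h.K_bilinear[OF y]])
  then show ?thesis
    using acceleration_square[OF p acc] umbilical_mean_curvature[OF p \<kappa>] by simp
qed

end

section \<open>Test curves and the shape operator at a point\<close>

context
  fixes c :: "('p, 'a) chart" and d :: "('p, 'b) chart" and p
  assumes c: "c \<in> A" and d: "d \<in> B" and p: "p \<in> cdom c" "p \<in> cdom d"
begin

interpretation h: hypersurface_in_coordinates "coord d ` (cdom c \<inter> cdom d)" "coord c \<circ> param d"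
  "\<lambda>y. \<xi> c (param d y)" "coord c ` cdom c" "\<lambda>x. g c (param c x)" "\<lambda>x. \<Gamma> c (param c x)" \<eta>
  by (rule in_coordinates[OF c d])

text \<open>The curve comes from one pair of charts, whereas \<open>unit_speed\<close> and
  \<open>C2_curve\<close> quantify over all charts: the former follows from independence of the
  ambient chart, the latter from smooth transition maps. The vector \<open>w\<close> may stay
  unspecified, since the normal component of the acceleration does not depend on it.\<close>

lemma unit_speed_curve_exists:
  assumes \<epsilon>: "induced_metric g d c p u u = \<epsilon>" "\<epsilon> = 1 \<or> \<epsilon> = -1"
  shows "\<exists>I \<alpha> w. C2_curve (subtopology T S) B I \<alpha> \<and> unit_speed A g I \<alpha> \<and> 0 \<in> I \<and> \<alpha> 0 = p \<and>
    acceleration \<Gamma> I \<alpha> c 0 = h.coord_acc (coord d p) u w \<and> induced_acceleration g \<Gamma> \<xi> \<eta> I \<alpha> c 0 = 0"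
proof -
  note ps = overlap_simps[OF c d p]
  obtain \<delta> z z' z'' k where \<delta>: "\<delta> > 0" and init: "z 0 = coord d p" "z' 0 = u"
    and z''_cont: "continuous_on {-\<delta><..<\<delta>} z''"
    and z: "\<forall>s\<in>{-\<delta><..<\<delta>}. z s \<in> coord d ` (cdom c \<inter> cdom d) \<and> h.K (z s) (z' s) (z' s) = \<epsilon> \<and>
      (z has_vector_derivative z' s) (at s) \<and> (z' has_vector_derivative z'' s) (at s)"
    and k: "h.coord_acc (coord d p) u (z'' 0) = k *\<^sub>R \<xi> c (param d (coord d p))"
    using h.unit_speed_curve_with_normal_acc[OF ps(3), of u \<epsilon>] \<epsilon>
    unfolding induced_metric_eq[OF c d p] by blast
  define I where "I = {-\<delta><..<\<delta>}"
  have I: "open I" "0 \<in> I" using \<delta> by (auto simp: I_def)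
  have zI: "z s \<in> coord d ` (cdom c \<inter> cdom d)" "h.K (z s) (z' s) (z' s) = \<epsilon>"
    "(z has_vector_derivative z' s) (at s)" "(z' has_vector_derivative z'' s) (at s)" if "s \<in> I" for s
    using z that by (auto simp: I_def)
  define \<alpha> where "\<alpha> s = param d (z s)" for s
  have \<alpha>: "\<alpha> s \<in> cdom c" "\<alpha> s \<in> cdom d" "coord d (\<alpha> s) = z s" if "s \<in> I" for s
    using zI(1)[OF that] param_coord[OF chart_B[OF d]] by (auto simp: \<alpha>_def)
  have \<alpha>0: "\<alpha> 0 = p" by (simp add: \<alpha>_def init ps)
  have z_within: "(coord d \<circ> \<alpha> has_vector_derivative z' t) (at t within I)"
    "(z' has_vector_derivative z'' t) (at t within I)" if "t \<in> I" for t
  proof -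
    show "(coord d \<circ> \<alpha> has_vector_derivative z' t) (at t within I)"
      using has_vector_derivative_at_within[OF zI(3)[OF that], of I]
      by (rule has_vector_derivative_transform[OF that, rotated]) (simp add: \<alpha>)
    show "(z' has_vector_derivative z'' t) (at t within I)"
      by (rule has_vector_derivative_at_within[OF zI(4)[OF that]])
  qed
  have nt: "at t within I \<noteq> bot" if "t \<in> I" for t
    using at_within_open[OF that I(1)] by simp
  have vel: "velocity I \<alpha> c' s = coord_deriv d c' (\<alpha> s) (z' s)"
    if "c' \<in> A" "s \<in> I" "\<alpha> s \<in> cdom c'" for c' s
  proof -
    have "continuous_on I z"
      using zI(3) has_vector_derivative_continuous continuous_at_imp_continuous_on by blast
    moreover have "open (coord d ` (cdom c' \<inter> cdom d))" by (rule overlap_open[OF that(1) d])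
    ultimately have J: "openin (top_of_set I) (I \<inter> z -` (coord d ` (cdom c' \<inter> cdom d)))"
      by (simp add: continuous_openin_preimage_gen)
    have J_dom: "\<alpha> t \<in> cdom c' \<inter> cdom d" if "t \<in> I \<inter> z -` (coord d ` (cdom c' \<inter> cdom d))" for t
      using that param_coord[OF chart_B[OF d]] by (auto simp: \<alpha>_def)
    show ?thesis
      by (rule curve_in_coordinates(1)[OF that(1) d J J_dom, where z'' = z''])
         (use nt z_within that \<alpha>[OF that(2)] in \<open>auto intro!: image_eqI[of _ _ "\<alpha> s"]\<close>)
  qed
  have acc: "acceleration \<Gamma> I \<alpha> c 0 = h.coord_acc (coord d p) u (z'' 0)"
    using curve_in_coordinates(2)[OF c d, of I I \<alpha> z' z'' 0] \<alpha> nt z_within I by (simp add: \<alpha>0 init)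
  have unit: "unit_speed A g I \<alpha>"
    unfolding unit_speed_def
  proof (intro bexI[of _ \<epsilon>] ballI impI)
    fix s c' assume s: "s \<in> I" and c': "c' \<in> A" "\<alpha> s \<in> cdom c'"
    have "g c' (\<alpha> s) (velocity I \<alpha> c' s) (velocity I \<alpha> c' s) = induced_metric g d c' (\<alpha> s) (z' s) (z' s)"
      by (simp add: vel[OF c'(1) s c'(2)] induced_metric_def)
    also have "\<dots> = induced_metric g d c (\<alpha> s) (z' s) (z' s)"
      by (rule induced_metric_chart_independent[OF c c'(1) d \<alpha>(1)[OF s] c'(2) \<alpha>(2)[OF s]])
    also have "\<dots> = \<epsilon>"
      using zI(2)[OF s] by (simp add: induced_metric_eq[OF c d \<alpha>(1,2)[OF s]] \<alpha>(3)[OF s])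
    finally show "g c' (\<alpha> s) (velocity I \<alpha> c' s) (velocity I \<alpha> c' s) = \<epsilon>" .
  qed (use \<epsilon> in auto)
  have "continuous_on I z"
    using zI(3) has_vector_derivative_continuous continuous_at_imp_continuous_on by blast
  then have "continuous_map (top_of_set I) (top_of_set (coord d ` cdom d)) z"
    using zI(1) by auto
  then have "continuous_map (top_of_set I) (subtopology (subtopology T S) (cdom d)) (param d \<circ> z)"
    using param_continuous[OF chart_B[OF d]] by (rule continuous_map_compose)
  then have cont: "continuous_map (top_of_set I) (subtopology T S) \<alpha>"
    using continuous_map_into_fulltopology by (simp add: \<alpha>_def[abs_def] o_def)
  have "C2_on (coord d' \<circ> \<alpha>) {s \<in> I. \<alpha> s \<in> cdom d'}" if d': "d' \<in> B" for d'
  proof -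
    let ?J = "{s \<in> I. \<alpha> s \<in> cdom d'}"
    have "C2_on z ?J"
      unfolding C2_on_def
    proof (rule exI[of _ z'], rule exI[of _ z''], intro conjI ballI)
      show "continuous_on ?J z''" by (rule continuous_on_subset[OF z''_cont]) (auto simp: I_def)
    qed (auto intro: has_vector_derivative_at_within[OF zI(3)] has_vector_derivative_at_within[OF zI(4)])
    moreover have "open (coord d ` (cdom d \<inter> cdom d'))"
      using chart_on_facts(1)[OF chart_B] d d' by (intro chart_image_open[OF chart_B[OF d]] openin_Int) auto
    ultimately have "C2_on (\<lambda>s. (coord d' \<circ> param d) (z s)) ?J"
      by (intro C2_on_smooth_compose[OF transition_smooth(2)[OF d d']])
         (auto simp: \<alpha>(2) simp flip: \<alpha>(3))
    then show ?thesis by (simp add: \<alpha>_def[abs_def] o_def)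
  qed
  then have "C2_curve (subtopology T S) B I \<alpha>"
    unfolding C2_curve_def using cont \<delta> I
    by (auto simp: I_def is_interval_oo interior_open)
  \<comment> \<open>The acceleration is \<open>k\<close> times the normal, and removing its normal
    component leaves nothing because \<eta> squares to 1.\<close>
  moreover have "induced_acceleration g \<Gamma> \<xi> \<eta> I \<alpha> c 0 = 0"
    using h.\<eta> h.X_unit[OF ps(3)] h.G_simps(5)[OF ps(3)]
    by (auto simp: induced_acceleration_def acc \<alpha>0 k ps)
  ultimately show ?thesis using unit I(2) \<alpha>0 acc by blast
qed

text \<open>The test curve with velocity \<open>u\<close> has zero intrinsic acceleration, so
  comparing \<open>eq\<close> with the Pythagorean formula and cancelling \<eta> gives the
  hypothesis of \<open>scalar_if_constant_squared_form\<close>, with the mean curvature at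
  \<open>p\<close> as the constant.\<close>

lemma shape_operator_scalar:
  assumes eq: "\<And>I \<alpha> s. \<lbrakk>C2_curve (subtopology T S) B I \<alpha>; unit_speed A g I \<alpha>; s \<in> I; \<alpha> s = p;
      induced_acceleration g \<Gamma> \<xi> \<eta> I \<alpha> c s = 0\<rbrakk> \<Longrightarrow>
      g c p (acceleration \<Gamma> I \<alpha> c s) (acceleration \<Gamma> I \<alpha> c s) = \<eta> * (mean_curvature \<Gamma> \<xi> \<eta> d c p)\<^sup>2"
  shows "\<exists>\<kappa>. \<forall>u. shape_operator \<Gamma> \<xi> d c p u = \<kappa> *\<^sub>R u"
proof -
  note ps = overlap_simps[OF c d p] and y = overlap_simps(3)[OF c d p]
  have "(h.K (coord d p) (h.shape (coord d p) u) u)\<^sup>2 = (mean_curvature \<Gamma> \<xi> \<eta> d c p)\<^sup>2"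
    if u: "h.K (coord d p) u u = 1 \<or> h.K (coord d p) u u = -1" for u
  proof -
    obtain I \<alpha> w where I: "C2_curve (subtopology T S) B I \<alpha>" "unit_speed A g I \<alpha>" "0 \<in> I" "\<alpha> 0 = p"
      and acc: "acceleration \<Gamma> I \<alpha> c 0 = h.coord_acc (coord d p) u w"
      and ind: "induced_acceleration g \<Gamma> \<xi> \<eta> I \<alpha> c 0 = 0"
      using unit_speed_curve_exists[OF refl, of u] u unfolding induced_metric_eq[OF c d p] by blast
    have "\<eta> * (mean_curvature \<Gamma> \<xi> \<eta> d c p)\<^sup>2 = g c p 0 0 + \<eta> * (h.K (coord d p) (h.shape (coord d p) u) u)\<^sup>2"
      using acceleration_square[OF c d, of \<alpha> 0 I u w] eq[OF I ind] p by (simp add: I acc ind)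
    moreover have "g c p 0 0 = 0" using h.G_simps(9)[OF y] by (simp add: ps)
    ultimately show ?thesis using h.\<eta> by auto
  qed
  then show ?thesis
    unfolding shape_operator_eq[OF c d p]
    by (rule scalar_if_constant_squared_form[OF h.K_bilinear[OF y] h.K_sym[OF y] h.K_nondegenerate[OF y]
          h.shape_linear[OF y] h.shape_self_adjoint[OF y]])
qed

end

text \<open>Being a geodesic is phrased with ambient charts only; a chart of the hypersurface has to
  be supplied before the mean curvature can be evaluated.\<close>

lemma chart_B_exists:
  assumes "C2_curve (subtopology T S) B I \<alpha>" "s \<in> I"
  shows "\<exists>d\<in>B. \<alpha> s \<in> cdom d"
proof -
  have "\<alpha> s \<in> topspace (subtopology T S)"
    using assms continuous_map_image_subset_topspace[of "top_of_set I" "subtopology T S" \<alpha>]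
    by (auto simp: C2_curve_def)
  then show ?thesis using hypersurface by (auto simp: hypersurface_def smooth_manifold_def)
qed

end

theorem theorem8:
  fixes T :: "'p topology"
    and A :: "('p, 'a::euclidean_space) chart set"
    and g :: "('p, 'a) metric"
    and \<nu> :: nat
    and \<Gamma> :: "('p, 'a) connection"
    and S :: "'p set"
    and B :: "('p, 'b::euclidean_space) chart set"
    and \<xi> :: "('p, 'a) vector_field"
    and \<eta> :: real
  assumes "semi_riemannian_manifold T A g \<nu> \<Gamma>"
    and "hypersurface T A S B"
    and "non_lightlike_hypersurface A B g"
    and "unit_normal_field A B g \<xi> \<eta>"
  shows "(totally_umbilical A B g \<Gamma> \<xi> \<longleftrightarrow>
      (\<forall>I \<alpha>. C2_curve (subtopology T S) B I \<alpha> \<and> unit_speed A g I \<alpha> \<longrightarrow>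
        (\<forall>s\<in>I. \<forall>c\<in>A. \<forall>d\<in>B. \<alpha> s \<in> cdom c \<inter> cdom d \<longrightarrow>
          (\<not> timelike (g c (\<alpha> s)) (induced_acceleration g \<Gamma> \<xi> \<eta> I \<alpha> c s) \<longrightarrow>
             g c (\<alpha> s) (acceleration \<Gamma> I \<alpha> c s) (acceleration \<Gamma> I \<alpha> c s)
               \<ge> \<eta> * (mean_curvature \<Gamma> \<xi> \<eta> d c (\<alpha> s))\<^sup>2) \<and>
          (\<not> spacelike (g c (\<alpha> s)) (induced_acceleration g \<Gamma> \<xi> \<eta> I \<alpha> c s) \<longrightarrow>
             g c (\<alpha> s) (acceleration \<Gamma> I \<alpha> c s) (acceleration \<Gamma> I \<alpha> c s)
               \<le> \<eta> * (mean_curvature \<Gamma> \<xi> \<eta> d c (\<alpha> s))\<^sup>2)))) \<and>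
    (totally_umbilical A B g \<Gamma> \<xi> \<longrightarrow>
      (\<forall>I \<alpha>. C2_curve (subtopology T S) B I \<alpha> \<and> unit_speed A g I \<alpha> \<and>
        (\<forall>s\<in>I. \<forall>c\<in>A. \<alpha> s \<in> cdom c \<longrightarrow>
          \<not> lightlike (g c (\<alpha> s)) (induced_acceleration g \<Gamma> \<xi> \<eta> I \<alpha> c s)) \<and>
        (\<forall>s\<in>I. \<forall>c\<in>A. \<forall>d\<in>B. \<alpha> s \<in> cdom c \<inter> cdom d \<longrightarrow>
          g c (\<alpha> s) (acceleration \<Gamma> I \<alpha> c s) (acceleration \<Gamma> I \<alpha> c s)
            = \<eta> * (mean_curvature \<Gamma> \<xi> \<eta> d c (\<alpha> s))\<^sup>2) \<longrightarrow>
        geodesic_of_hypersurface A g \<Gamma> \<xi> \<eta> I \<alpha>))"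
proof -
  interpret semi_riemannian_hypersurface T A g \<nu> \<Gamma> S B \<xi> \<eta>
    using assms by unfold_locales
  have zero: "g c p 0 0 = 0" if "c \<in> A" "p \<in> cdom c" for c p
    using manifold that bilinear_lzero
    unfolding semi_riemannian_manifold_def semi_riemannian_metric_def by blast
  have nonneg: "g c (\<alpha> s) v v \<ge> 0" if "c \<in> A" "\<alpha> s \<in> cdom c" "\<not> timelike (g c (\<alpha> s)) v"
    for c v and \<alpha> :: "real \<Rightarrow> 'p" and s
    using that zero by (cases "v = 0") (auto simp: timelike_def)
  have nonpos: "g c (\<alpha> s) v v \<le> 0" if "c \<in> A" "\<alpha> s \<in> cdom c" "\<not> spacelike (g c (\<alpha> s)) v"
    for c v and \<alpha> :: "real \<Rightarrow> 'p" and s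
    using that zero by (cases "v = 0") (auto simp: spacelike_def)
  show ?thesis
  proof (rule conjI, rule iffI, goal_cases)
    case 1
    then show ?case
      using curve_acceleration_square nonneg nonpos by auto
  next
    case 2
    show ?case
      unfolding totally_umbilical_def
    proof (intro ballI allI impI)
      fix c d p u assume cd: "c \<in> A" "d \<in> B" "p \<in> cdom c \<inter> cdom d"
      have "\<exists>\<kappa>. \<forall>u. shape_operator \<Gamma> \<xi> d c p u = \<kappa> *\<^sub>R u"
      proof (rule shape_operator_scalar[OF cd(1,2)])
        fix I \<alpha> s
        assume \<alpha>: "C2_curve (subtopology T S) B I \<alpha>" "unit_speed A g I \<alpha>" "s \<in> I" "\<alpha> s = p"
          and ind: "induced_acceleration g \<Gamma> \<xi> \<eta> I \<alpha> c s = 0"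
        \<comment> \<open>The zero vector satisfies the premises of both inequalities, which
          together give equality.\<close>
        have "\<not> timelike (g c p) 0" "\<not> spacelike (g c p) 0" by (auto simp: timelike_def spacelike_def)
        then show "g c p (acceleration \<Gamma> I \<alpha> c s) (acceleration \<Gamma> I \<alpha> c s)
            = \<eta> * (mean_curvature \<Gamma> \<xi> \<eta> d c p)\<^sup>2"
          using 2[rule_format, of I \<alpha> s c d] \<alpha> ind cd by (auto intro: antisym)
      qed (use cd in auto)
      then show "\<exists>\<kappa>. shape_operator \<Gamma> \<xi> d c p u = \<kappa> *\<^sub>R u" by blast
    qed
  next
    case 3
    show ?case
    proof (intro impI allI, elim conjE)
      fix I \<alpha>
      assume umbilical: "totally_umbilical A B g \<Gamma> \<xi>"
        and \<alpha>: "C2_curve (subtopology T S) B I \<alpha>" "unit_speed A g I \<alpha>"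
        and not_lightlike: "\<forall>s\<in>I. \<forall>c\<in>A. \<alpha> s \<in> cdom c \<longrightarrow>
          \<not> lightlike (g c (\<alpha> s)) (induced_acceleration g \<Gamma> \<xi> \<eta> I \<alpha> c s)"
        and eq: "\<forall>s\<in>I. \<forall>c\<in>A. \<forall>d\<in>B. \<alpha> s \<in> cdom c \<inter> cdom d \<longrightarrow>
          g c (\<alpha> s) (acceleration \<Gamma> I \<alpha> c s) (acceleration \<Gamma> I \<alpha> c s)
            = \<eta> * (mean_curvature \<Gamma> \<xi> \<eta> d c (\<alpha> s))\<^sup>2"
      show "geodesic_of_hypersurface A g \<Gamma> \<xi> \<eta> I \<alpha>"
        unfolding geodesic_of_hypersurface_def
      proof (intro ballI impI)
        fix s c assume s: "s \<in> I" "c \<in> A" "\<alpha> s \<in> cdom c"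
        obtain d where d: "d \<in> B" "\<alpha> s \<in> cdom d" using chart_B_exists[OF \<alpha>(1) s(1)] by blast
        \<comment> \<open>Equality cancels the curvature terms. The resulting null vector is zero or
          lightlike, and \<open>not_lightlike\<close> leaves only zero.\<close>
        have "g c (\<alpha> s) (induced_acceleration g \<Gamma> \<xi> \<eta> I \<alpha> c s) (induced_acceleration g \<Gamma> \<xi> \<eta> I \<alpha> c s) = 0"
          using curve_acceleration_square[OF s(2) d(1) \<alpha> s(1,3) d(2) umbilical] eq s d by simp
        then show "induced_acceleration g \<Gamma> \<xi> \<eta> I \<alpha> c s = 0"
          using not_lightlike s by (auto simp: lightlike_def)
      qed
    qed
  qed
qed

end
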